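(* Let $\lambda\in\mathbb C\setminus(\mathbb Z\setminus\{0\})$ and let $V=M^{\lambda-1}$ be the Verma module over $\mathfrak{sl}(2)$ with highest weight $\lambda-1$, regarded as a $\mathfrak{gl}(\lambda)$-module. Let $n\ge1$ and let $\mathfrak{gl}(\lambda)$ act on $V^{\otimes n}$ by $a\mapsto\sum_{j=1}^n 1\otimes\cdots\otimes a\otimes\cdots\otimes1$ ($a$ in the $j$-th place) and $\mathfrak S_n$ act by permuting the factors. Then $$V^{\otimes n}=\bigoplus_{\nu}V^{\nu}\otimes S^{\nu}$$ as a $\mathfrak{gl}(\lambda)\times\mathfrak S_n$-module, where $\nu$ runs over the partitions of $n$, $S^\nu$ is the irreducible $\mathfrak S_n$-module corresponding to $\nu$, and each $V^\nu$ is an irreducible $\mathfrak{gl}(\lambda)$-module.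
   Context: $\mathfrak{sl}(2)$ has basis $X,H,Y$ with $[X,Y]=H$, $[H,X]=2X$, $[H,Y]=-2Y$. For $\lambda\in\mathbb C\setminus(\mathbb Z\setminus\{0\})$, $\mathfrak A_\lambda=U(\mathfrak{sl}(2))/I_\lambda$ where $I_\lambda$ is the two-sided ideal generated by $\Omega-\frac12(\lambda^2-1)$, $\Omega=2YX+\frac12H^2+H$; $\mathfrak{gl}(\lambda)$ is $\mathfrak A_\lambda$ with bracket $[a,b]=ab-ba$. The Verma module $M^{\lambda-1}$ is generated by $v$ with $Xv=0$, $Hv=(\lambda-1)v$, with basis $Y^jv$, $j\ge0$; $\Omega$ acts on it by $\frac12(\lambda^2-1)$, so it is an $\mathfrak A_\lambda$-module and hence a $\mathfrak{gl}(\lambda)$-module. *)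

theory Defs
  imports Complex_Main "HOL-Combinatorics.Permutations"
begin

text \<open>Vectors of V = M^(lam-1) are coordinate functions nat => complex w.r.t. the
basis e_j = Y^j v (finitely supported ones being the actual module elements).\<close>

type_synonym vec = "nat \<Rightarrow> complex"

definition ebasis :: "nat \<Rightarrow> vec" where
  "ebasis k = (\<lambda>i. if i = k then 1 else 0)"

text \<open>Y e_j = e_(j+1);  H e_j = (lam-1-2j) e_j;  X e_j = j(lam-j) e_(j-1)  (X e_0 = 0).\<close>

definition Y_op :: "vec \<Rightarrow> vec" where
  "Y_op f = (\<lambda>i. if i = 0 then 0 else f (i - 1))"

definition H_op :: "complex \<Rightarrow> vec \<Rightarrow> vec" where
  "H_op lam f = (\<lambda>i. (lam - 1 - 2 * of_nat i) * f i)"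

definition X_op :: "complex \<Rightarrow> vec \<Rightarrow> vec" where
  "X_op lam f = (\<lambda>i. of_nat (Suc i) * (lam - of_nat (Suc i)) * f (Suc i))"

text \<open>The operators by which elements of A_lam (= U(sl2)/I_lam) act on V: the unital
associative algebra generated by X, H, Y.  The gl(lam)-action of a on V is this
operator; the Lie bracket is the commutator.\<close>

inductive_set verma_ops :: "complex \<Rightarrow> (vec \<Rightarrow> vec) set" for lam :: complex where
  ops_id: "id \<in> verma_ops lam"
| ops_X: "X_op lam \<in> verma_ops lam"
| ops_H: "H_op lam \<in> verma_ops lam"
| ops_Y: "Y_op \<in> verma_ops lam"
| ops_add: "S \<in> verma_ops lam \<Longrightarrow> T \<in> verma_ops lam \<Longrightarrow> (\<lambda>f i. S f i + T f i) \<in> verma_ops lam"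
| ops_smult: "T \<in> verma_ops lam \<Longrightarrow> (\<lambda>f i. c * T f i) \<in> verma_ops lam"
| ops_comp: "S \<in> verma_ops lam \<Longrightarrow> T \<in> verma_ops lam \<Longrightarrow> S \<circ> T \<in> verma_ops lam"

text \<open>An element of V^(\<otimes> n) is a finitely supported coefficient function on the basis
e_(xs!0) \<otimes> ... \<otimes> e_(xs!(n-1)), indexed by lists xs of length n.\<close>

type_synonym tensor = "nat list \<Rightarrow> complex"

definition tensor_space :: "nat \<Rightarrow> tensor set" where
  "tensor_space n = {f. finite {xs. f xs \<noteq> 0} \<and> (\<forall>xs. f xs \<noteq> 0 \<longrightarrow> length xs = n)}"

text \<open>1 \<otimes> ... \<otimes> T \<otimes> ... \<otimes> 1 with T in the j-th place (j counted from 0).\<close>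

definition act_at :: "(vec \<Rightarrow> vec) \<Rightarrow> nat \<Rightarrow> tensor \<Rightarrow> tensor" where
  "act_at T j f = (\<lambda>xs. \<Sum>ys \<in> {ys. f ys \<noteq> 0 \<and> length ys = length xs \<and>
                                   (\<forall>i. i \<noteq> j \<longrightarrow> ys ! i = xs ! i)}.
                        f ys * T (ebasis (ys ! j)) (xs ! j))"

definition gl_act :: "(vec \<Rightarrow> vec) \<Rightarrow> nat \<Rightarrow> tensor \<Rightarrow> tensor" where
  "gl_act T n f = (\<lambda>xs. \<Sum>j<n. act_at T j f xs)"

text \<open>Action of S_n (permutations of {0..<n}) by permuting tensor factors:
sigma (v_0 \<otimes> ... \<otimes> v_(n-1)) has v_i in position sigma i.\<close>

definition sym_act :: "nat \<Rightarrow> (nat \<Rightarrow> nat) \<Rightarrow> tensor \<Rightarrow> tensor" where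
  "sym_act n \<sigma> f = (\<lambda>xs. if length xs = n then f (map (\<lambda>i. xs ! \<sigma> i) [0..<n]) else 0)"

definition is_subspace :: "('a \<Rightarrow> complex) set \<Rightarrow> bool" where
  "is_subspace U \<longleftrightarrow> (\<lambda>_. 0) \<in> U \<and> (\<forall>f\<in>U. \<forall>g\<in>U. (\<lambda>x. f x + g x) \<in> U) \<and>
                     (\<forall>c. \<forall>f\<in>U. (\<lambda>x. c * f x) \<in> U)"

definition gl_invariant :: "complex \<Rightarrow> nat \<Rightarrow> tensor set \<Rightarrow> bool" where
  "gl_invariant lam n U \<longleftrightarrow> (\<forall>T\<in>verma_ops lam. \<forall>f\<in>U. gl_act T n f \<in> U)"

definition gl_irreducible_sub :: "complex \<Rightarrow> nat \<Rightarrow> tensor set \<Rightarrow> bool" where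
  "gl_irreducible_sub lam n U \<longleftrightarrow>
     is_subspace U \<and> U \<subseteq> tensor_space n \<and> gl_invariant lam n U \<and> U \<noteq> {\<lambda>_. 0} \<and>
     (\<forall>U'. is_subspace U' \<and> U' \<subseteq> U \<and> gl_invariant lam n U' \<longrightarrow> U' = {\<lambda>_. 0} \<or> U' = U)"

definition partitions :: "nat \<Rightarrow> nat list set" where
  "partitions n = {\<nu>. sorted_wrt (\<ge>) \<nu> \<and> 0 \<notin> set \<nu> \<and> sum_list \<nu> = n}"

definition Perms :: "nat \<Rightarrow> (nat \<Rightarrow> nat) set" where
  "Perms n = {p. p permutes {..<n}}"

type_synonym galg = "(nat \<Rightarrow> nat) \<Rightarrow> complex"

definition group_algebra :: "nat \<Rightarrow> galg set" where
  "group_algebra n = {f. \<forall>p. f p \<noteq> 0 \<longrightarrow> p \<in> Perms n}"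

definition ga_mult :: "nat \<Rightarrow> galg \<Rightarrow> galg \<Rightarrow> galg" where
  "ga_mult n f g = (\<lambda>\<pi>. \<Sum>\<sigma>\<in>Perms n. \<Sum>\<tau>\<in>Perms n. if \<sigma> \<circ> \<tau> = \<pi> then f \<sigma> * g \<tau> else 0)"

definition ga_delta :: "(nat \<Rightarrow> nat) \<Rightarrow> galg" where
  "ga_delta \<sigma> = (\<lambda>\<pi>. if \<pi> = \<sigma> then 1 else 0)"

definition tab_row :: "nat list \<Rightarrow> nat \<Rightarrow> nat set" where
  "tab_row \<nu> r = {sum_list (take r \<nu>) ..< sum_list (take (Suc r) \<nu>)}"

definition tab_col :: "nat list \<Rightarrow> nat \<Rightarrow> nat set" where
  "tab_col \<nu> c = {sum_list (take r \<nu>) + c | r. r < length \<nu> \<and> c < \<nu> ! r}"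

definition row_group :: "nat \<Rightarrow> nat list \<Rightarrow> (nat \<Rightarrow> nat) set" where
  "row_group n \<nu> = {p \<in> Perms n. \<forall>r<length \<nu>. p ` tab_row \<nu> r = tab_row \<nu> r}"

definition col_group :: "nat \<Rightarrow> nat list \<Rightarrow> (nat \<Rightarrow> nat) set" where
  "col_group n \<nu> = {p \<in> Perms n. \<forall>c. p ` tab_col \<nu> c = tab_col \<nu> c}"

definition young_symmetrizer :: "nat \<Rightarrow> nat list \<Rightarrow> galg" where
  "young_symmetrizer n \<nu> =
     ga_mult n (\<lambda>p. if p \<in> row_group n \<nu> then 1 else 0)
               (\<lambda>p. if p \<in> col_group n \<nu> then of_int (sign p) else 0)"

definition specht :: "nat \<Rightarrow> nat list \<Rightarrow> galg set" where
  "specht n \<nu> = {ga_mult n g (young_symmetrizer n \<nu>) | g. g \<in> group_algebra n}"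

definition specht_act :: "nat \<Rightarrow> (nat \<Rightarrow> nat) \<Rightarrow> galg \<Rightarrow> galg" where
  "specht_act n \<sigma> s = ga_mult n (ga_delta \<sigma>) s"

text \<open>B nu is a bilinear map V^nu \<times> S^nu -> V^(\<otimes> n); the induced linear map
\<Oplus>_nu V^nu \<otimes> S^nu -> V^(\<otimes> n) is required to be a bijective gl(lam) \<times> S_n-map.\<close>

definition bilinear_on :: "('a \<Rightarrow> complex) set \<Rightarrow> ('b \<Rightarrow> complex) set \<Rightarrow>
     (('a \<Rightarrow> complex) \<Rightarrow> ('b \<Rightarrow> complex) \<Rightarrow> ('c \<Rightarrow> complex)) \<Rightarrow> bool" where
  "bilinear_on W S B \<longleftrightarrow>
     (\<forall>w\<in>W. \<forall>w'\<in>W. \<forall>s\<in>S. \<forall>c c'.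
        B (\<lambda>x. c * w x + c' * w' x) s = (\<lambda>y. c * B w s y + c' * B w' s y)) \<and>
     (\<forall>w\<in>W. \<forall>s\<in>S. \<forall>s'\<in>S. \<forall>c c'.
        B w (\<lambda>x. c * s x + c' * s' x) = (\<lambda>y. c * B w s y + c' * B w s' y))"

definition lin_indep_family :: "nat \<Rightarrow> (nat \<Rightarrow> 'a \<Rightarrow> complex) \<Rightarrow> bool" where
  "lin_indep_family k s \<longleftrightarrow>
     (\<forall>c :: nat \<Rightarrow> complex. (\<forall>x. (\<Sum>i<k. c i * s i x) = 0) \<longrightarrow> (\<forall>i<k. c i = 0))"

definition schur_weyl_decomposition ::
  "complex \<Rightarrow> nat \<Rightarrow> (nat list \<Rightarrow> tensor set) \<Rightarrow> (nat list \<Rightarrow> tensor \<Rightarrow> galg \<Rightarrow> tensor) \<Rightarrow> bool" where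
  "schur_weyl_decomposition lam n W B \<longleftrightarrow>
     \<comment> \<open>each V^nu is an irreducible gl(lam)-module\<close>
     (\<forall>\<nu>\<in>partitions n. gl_irreducible_sub lam n (W \<nu>)) \<and>
     \<comment> \<open>B nu is bilinear with values in V^(\<otimes> n)\<close>
     (\<forall>\<nu>\<in>partitions n. bilinear_on (W \<nu>) (specht n \<nu>) (B \<nu>) \<and>
        (\<forall>w\<in>W \<nu>. \<forall>s\<in>specht n \<nu>. B \<nu> w s \<in> tensor_space n)) \<and>
     \<comment> \<open>gl(lam)-equivariance\<close>
     (\<forall>\<nu>\<in>partitions n. \<forall>T\<in>verma_ops lam. \<forall>w\<in>W \<nu>. \<forall>s\<in>specht n \<nu>.
        gl_act T n (B \<nu> w s) = B \<nu> (gl_act T n w) s) \<and>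
     \<comment> \<open>S_n-equivariance\<close>
     (\<forall>\<nu>\<in>partitions n. \<forall>\<sigma>\<in>Perms n. \<forall>w\<in>W \<nu>. \<forall>s\<in>specht n \<nu>.
        sym_act n \<sigma> (B \<nu> w s) = B \<nu> w (specht_act n \<sigma> s)) \<and>
     \<comment> \<open>surjectivity of the induced map\<close>
     (\<forall>f\<in>tensor_space n. \<exists>(k::nat) (\<mu> :: nat \<Rightarrow> nat list) (w :: nat \<Rightarrow> tensor) (s :: nat \<Rightarrow> galg).
        (\<forall>i<k. \<mu> i \<in> partitions n \<and> w i \<in> W (\<mu> i) \<and> s i \<in> specht n (\<mu> i)) \<and>
        f = (\<lambda>xs. \<Sum>i<k. B (\<mu> i) (w i) (s i) xs)) \<and>
     \<comment> \<open>injectivity of the induced map on \<Oplus>_nu V^nu \<otimes> S^nu\<close>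
     (\<forall>(k :: nat list \<Rightarrow> nat) (w :: nat list \<Rightarrow> nat \<Rightarrow> tensor) (s :: nat list \<Rightarrow> nat \<Rightarrow> galg).
        (\<forall>\<nu>\<in>partitions n. lin_indep_family (k \<nu>) (s \<nu>) \<and>
                 (\<forall>i<k \<nu>. w \<nu> i \<in> W \<nu> \<and> s \<nu> i \<in> specht n \<nu>)) \<and>
              (\<forall>xs. (\<Sum>\<nu>\<in>partitions n. \<Sum>i<k \<nu>. B \<nu> (w \<nu> i) (s \<nu> i) xs) = 0) \<longrightarrow>
              (\<forall>\<nu>\<in>partitions n. \<forall>i<k \<nu>. w \<nu> i = (\<lambda>_. 0)))"

end

theory Submission
  imports Defs "HOL-Combinatorics.Cycles"
begin

text \<open>
  Let \<open>A\<close> be the group algebra of the symmetric group, \<open>c\<^sub>\<nu> = a\<^sub>\<nu> b\<^sub>\<nu>\<close> the Young symmetrizers, and take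
  \<open>c\<^sub>\<nu> V\<^sup>\<otimes>\<^sup>n\<close> for \<open>V\<^sup>\<nu>\<close>, with \<open>w \<otimes> s \<mapsto> s w\<close> for \<open>s \<in> A c\<^sub>\<nu>\<close>. Young's lemma gives
  \<open>c\<^sub>\<nu> A c\<^sub>\<nu> = \<complex> c\<^sub>\<nu>\<close> and \<open>c\<^sub>\<nu> A c\<^sub>\<mu> = 0\<close> for \<open>\<nu> \<noteq> \<mu>\<close>; positivity of \<open>x\<^sup>* x\<close> shows that \<open>x A x = 0\<close> only for
  \<open>x = 0\<close>, which replaces semisimplicity throughout. The map is onto because the averages
  \<open>\<Sum> g c\<^sub>\<nu> g\<^sup>-\<^sup>1\<close> are independent class functions, as many as there are partitions, so that \<open>1\<close> is
  a combination of them. For irreducibility, polynomials in \<open>H\<close> together with \<open>X\<close> and \<open>Y\<close> yield every matrix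
  unit on a given finite part of \<open>V\<close> (here \<open>\<lambda>\<close> must not be a positive integer); matrix units move
  any nonzero vector of \<open>c\<^sub>\<nu> V\<^sup>\<otimes>\<^sup>n\<close> into a multiplicity-free weight space, which is a copy of \<open>A\<close>,
  and there the statement is that \<open>c\<^sub>\<nu> A\<close> is a minimal right ideal.
\<close>

text \<open>The c_\<nu> are only quasi-idempotent: c_\<nu> c_\<nu> = h c_\<nu>, and h has to be
  nonzero. With R and C the row and column groups, c c^* c = |R| |C| c c, so h = 0 would force c =
  0, although the coefficient of c at the identity is 1. The combinatorics of tableaux gives c_\<nu>
  A c_\<mu> = 0 only in the order determined by comparing sums of row indices. Positivity supplies
  the other order, because z = c_\<nu> x c_\<mu> satisfies z A z = 0 as soon as c_\<mu> A c_\<nu> =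
  0. On the other hand no matrix unit lies in the acting algebra; but a single tensor involves
  finitely many basis vectors, and on those some element of the algebra agrees with the matrix unit.
  A relation in the direct sum is tested at one coordinate of the tensor space at a time, which
  turns it into a statement about a single element of A.\<close>

lemma finite_Perms [simp]: "finite (Perms n)"
  unfolding Perms_def by (simp add: finite_permutations)

lemma id_in_Perms [simp]: "id \<in> Perms n"
  unfolding Perms_def by (simp add: permutes_id)

lemma comp_in_Perms [intro]: "\<sigma> \<in> Perms n \<Longrightarrow> \<tau> \<in> Perms n \<Longrightarrow> \<sigma> \<circ> \<tau> \<in> Perms n"
  unfolding Perms_def by (simp add: permutes_compose)

lemma inv_in_Perms [intro]: "\<sigma> \<in> Perms n \<Longrightarrow> inv \<sigma> \<in> Perms n"
  unfolding Perms_def by (simp add: permutes_inv)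

lemma bij_Perms: "\<sigma> \<in> Perms n \<Longrightarrow> bij \<sigma>"
  unfolding Perms_def by (auto intro: permutes_bij)

lemma inv_inv_Perms: "\<sigma> \<in> Perms n \<Longrightarrow> inv (inv \<sigma>) = \<sigma>"
  by (simp add: bij_Perms inv_inv_eq)

lemma comp_inv_Perms:
  assumes "\<sigma> \<in> Perms n"
  shows "\<sigma> \<circ> inv \<sigma> = id" "inv \<sigma> \<circ> \<sigma> = id" "\<sigma> (inv \<sigma> x) = x" "inv \<sigma> (\<sigma> x) = x"
    "\<sigma> \<circ> (inv \<sigma> \<circ> h) = h" "inv \<sigma> \<circ> (\<sigma> \<circ> h) = h" "k \<circ> \<sigma> \<circ> inv \<sigma> = k" "k \<circ> inv \<sigma> \<circ> \<sigma> = k"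
proof -
  have b: "bij \<sigma>" using assms by (rule bij_Perms)
  show A: "\<sigma> (inv \<sigma> x) = x" "inv \<sigma> (\<sigma> x) = x" for x
    using b by (simp_all add: bij_is_surj bij_is_inj surj_f_inv_f)
  show "\<sigma> \<circ> inv \<sigma> = id" "inv \<sigma> \<circ> \<sigma> = id" "\<sigma> \<circ> (inv \<sigma> \<circ> h) = h" "inv \<sigma> \<circ> (\<sigma> \<circ> h) = h"
    "k \<circ> \<sigma> \<circ> inv \<sigma> = k" "k \<circ> inv \<sigma> \<circ> \<sigma> = k"
    by (simp_all add: fun_eq_iff A)
qed

lemma comp_eq_iff_Perms:
  assumes "\<sigma> \<in> Perms n"
  shows "\<sigma> \<circ> \<tau> = \<pi> \<longleftrightarrow> \<tau> = inv \<sigma> \<circ> \<pi>" "\<tau> \<circ> \<sigma> = \<pi> \<longleftrightarrow> \<tau> = \<pi> \<circ> inv \<sigma>"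
  by (metis assms comp_inv_Perms(5,6)) (metis assms comp_inv_Perms(7,8))

lemma Perms_less: "\<sigma> \<in> Perms n \<Longrightarrow> \<sigma> i < n \<longleftrightarrow> i < n"
  unfolding Perms_def using permutes_in_image by fastforce

lemma bij_betw_Perms: "\<sigma> \<in> Perms n \<Longrightarrow> bij_betw \<sigma> {..<n} {..<n}"
  unfolding Perms_def by (simp add: permutes_imp_bij)

lemma bij_betw_inv_Perms: "bij_betw inv (Perms n) (Perms n)"
  by (rule bij_betw_byWitness[where f' = inv]) (auto simp: inv_inv_Perms)

lemma bij_betw_comp_left_Perms:
  "\<tau> \<in> Perms n \<Longrightarrow> bij_betw (\<lambda>\<sigma>. \<tau> \<circ> \<sigma>) (Perms n) (Perms n)"
  by (rule bij_betw_byWitness[where f' = "\<lambda>\<sigma>. inv \<tau> \<circ> \<sigma>"]) (auto simp: comp_inv_Perms)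

section \<open>The group algebra\<close>

lemma group_algebraD: "f \<in> group_algebra n \<Longrightarrow> p \<notin> Perms n \<Longrightarrow> f p = 0"
  unfolding group_algebra_def by blast

text \<open>The involution x^* of the overview. Multiplication by it is adjoint to multiplication by
  x for the standard inner product on A, so the coefficient of x^* x at \<open>id\<close> is a sum
  of squared absolute values.\<close>

definition ga_adj :: "nat \<Rightarrow> galg \<Rightarrow> galg" where
  "ga_adj n f = (\<lambda>\<pi>. if \<pi> \<in> Perms n then cnj (f (inv \<pi>)) else 0)"

context
  fixes n :: nat
begin

abbreviation ga_mult_n :: "galg \<Rightarrow> galg \<Rightarrow> galg" (infixl "\<star>" 70) where
  "f \<star> g \<equiv> ga_mult n f g"

text \<open>Stated for an arbitrary weight \<open>h\<close>, so that it serves both associativity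
  and \<open>ga_act_mult\<close>; in the latter \<open>h\<close> is a coefficient of the permuted
  tensor.\<close>

lemma sum_ga_mult:
  "(\<Sum>\<pi>\<in>Perms n. (f \<star> g) \<pi> * h \<pi>) = (\<Sum>\<sigma>\<in>Perms n. \<Sum>\<tau>\<in>Perms n. f \<sigma> * g \<tau> * h (\<sigma> \<circ> \<tau>))"
proof -
  have "(\<Sum>\<pi>\<in>Perms n. (f \<star> g) \<pi> * h \<pi>) =
    (\<Sum>\<pi>\<in>Perms n. \<Sum>\<sigma>\<in>Perms n. \<Sum>\<tau>\<in>Perms n. if \<pi> = \<sigma> \<circ> \<tau> then f \<sigma> * g \<tau> * h \<pi> else 0)"
    unfolding ga_mult_def sum_distrib_right by (intro sum.cong refl) auto
  also have "\<dots> = (\<Sum>\<sigma>\<in>Perms n. \<Sum>\<pi>\<in>Perms n. \<Sum>\<tau>\<in>Perms n. if \<pi> = \<sigma> \<circ> \<tau> then f \<sigma> * g \<tau> * h \<pi> else 0)"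
    by (rule sum.swap)
  also have "\<dots> = (\<Sum>\<sigma>\<in>Perms n. \<Sum>\<tau>\<in>Perms n. \<Sum>\<pi>\<in>Perms n. if \<pi> = \<sigma> \<circ> \<tau> then f \<sigma> * g \<tau> * h \<pi> else 0)"
    by (intro sum.cong refl sum.swap)
  also have "\<dots> = (\<Sum>\<sigma>\<in>Perms n. \<Sum>\<tau>\<in>Perms n. f \<sigma> * g \<tau> * h (\<sigma> \<circ> \<tau>))"
    by (intro sum.cong refl) (auto simp: comp_in_Perms)
  finally show ?thesis .
qed

lemma ga_mult_assoc: "f \<star> g \<star> k = f \<star> (g \<star> k)"
proof
  fix \<pi>
  have "(f \<star> g \<star> k) \<pi> = (\<Sum>\<rho>\<in>Perms n. (f \<star> g) \<rho> * (\<Sum>\<tau>\<in>Perms n. if \<rho> \<circ> \<tau> = \<pi> then k \<tau> else 0))"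
    unfolding ga_mult_def[of n "f \<star> g" k] sum_distrib_left by (intro sum.cong refl) auto
  also have "\<dots> = (\<Sum>\<sigma>\<in>Perms n. \<Sum>\<rho>\<in>Perms n. f \<sigma> * g \<rho> * (\<Sum>\<tau>\<in>Perms n. if \<sigma> \<circ> \<rho> \<circ> \<tau> = \<pi> then k \<tau> else 0))"
    by (rule sum_ga_mult)
  also have "\<dots> = (\<Sum>\<sigma>\<in>Perms n. f \<sigma> * (\<Sum>\<rho>\<in>Perms n. \<Sum>\<tau>\<in>Perms n. g \<rho> * k \<tau> * (if \<sigma> \<circ> (\<rho> \<circ> \<tau>) = \<pi> then 1 else 0)))"
    unfolding sum_distrib_left by (intro sum.cong refl) (auto simp: o_assoc)
  also have "\<dots> = (\<Sum>\<sigma>\<in>Perms n. f \<sigma> * (\<Sum>\<rho>\<in>Perms n. (g \<star> k) \<rho> * (if \<sigma> \<circ> \<rho> = \<pi> then 1 else 0)))"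
    by (subst sum_ga_mult) simp
  also have "\<dots> = (f \<star> (g \<star> k)) \<pi>"
    unfolding ga_mult_def[of n f "g \<star> k"] sum_distrib_left by (intro sum.cong refl) auto
  finally show "(f \<star> g \<star> k) \<pi> = (f \<star> (g \<star> k)) \<pi>" .
qed

lemma ga_mult_notin: "\<pi> \<notin> Perms n \<Longrightarrow> (f \<star> g) \<pi> = 0"
  unfolding ga_mult_def by (intro sum.neutral ballI) auto

lemma ga_mult_in [simp, intro]: "f \<star> g \<in> group_algebra n"
  unfolding group_algebra_def using ga_mult_notin by blast

lemma ga_mult_eq_left:
  assumes "\<pi> \<in> Perms n"
  shows "(f \<star> g) \<pi> = (\<Sum>\<sigma>\<in>Perms n. f \<sigma> * g (inv \<sigma> \<circ> \<pi>))"
  unfolding ga_mult_def using assms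
  by (intro sum.cong refl) (auto simp: comp_eq_iff_Perms comp_in_Perms inv_in_Perms)

lemma ga_mult_eq_right:
  assumes "\<pi> \<in> Perms n"
  shows "(f \<star> g) \<pi> = (\<Sum>\<tau>\<in>Perms n. f (\<pi> \<circ> inv \<tau>) * g \<tau>)"
  unfolding ga_mult_def using assms
  by (subst sum.swap, intro sum.cong refl)
    (auto simp: comp_eq_iff_Perms(2) comp_in_Perms inv_in_Perms if_distrib
      simp del: comp_apply cong: if_cong)

lemma ga_mult_sum_left:
  "(\<lambda>\<pi>. \<Sum>i\<in>I. k i * F i \<pi>) \<star> g = (\<lambda>\<pi>. \<Sum>i\<in>I. k i * (F i \<star> g) \<pi>)"
proof
  fix \<pi>
  show "((\<lambda>\<pi>. \<Sum>i\<in>I. k i * F i \<pi>) \<star> g) \<pi> = (\<Sum>i\<in>I. k i * (F i \<star> g) \<pi>)"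
  proof (cases "\<pi> \<in> Perms n")
    case True
    then show ?thesis
      by (simp add: ga_mult_eq_left sum_distrib_left sum_distrib_right mult.assoc) (rule sum.swap)
  qed (simp add: ga_mult_notin)
qed

lemma ga_mult_sum_right:
  "g \<star> (\<lambda>\<pi>. \<Sum>i\<in>I. k i * F i \<pi>) = (\<lambda>\<pi>. \<Sum>i\<in>I. k i * (g \<star> F i) \<pi>)"
proof
  fix \<pi>
  show "(g \<star> (\<lambda>\<pi>. \<Sum>i\<in>I. k i * F i \<pi>)) \<pi> = (\<Sum>i\<in>I. k i * (g \<star> F i) \<pi>)"
  proof (cases "\<pi> \<in> Perms n")
    case True
    then show ?thesis
      by (simp add: ga_mult_eq_left sum_distrib_left)
        (subst sum.swap, intro sum.cong refl, simp)
  qed (simp add: ga_mult_notin)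
qed

lemma ga_mult_scale_left: "(\<lambda>\<pi>. k * f \<pi>) \<star> g = (\<lambda>\<pi>. k * (f \<star> g) \<pi>)"
  using ga_mult_sum_left[of "\<lambda>_. k" "\<lambda>_. f" "{()}" g] by simp

lemma ga_mult_scale_right: "g \<star> (\<lambda>\<pi>. k * f \<pi>) = (\<lambda>\<pi>. k * (g \<star> f) \<pi>)"
  using ga_mult_sum_right[of g "\<lambda>_. k" "\<lambda>_. f" "{()}"] by simp

lemma ga_mult_zero [simp]: "(\<lambda>_. 0) \<star> f = (\<lambda>_. 0)" "f \<star> (\<lambda>_. 0) = (\<lambda>_. 0)"
  by (simp_all add: ga_mult_def fun_eq_iff cong: if_cong)

lemma ga_delta_in: "\<sigma> \<in> Perms n \<Longrightarrow> ga_delta \<sigma> \<in> group_algebra n"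
  unfolding group_algebra_def ga_delta_def by auto

lemma ga_delta_mult_left: "\<sigma> \<in> Perms n \<Longrightarrow> \<pi> \<in> Perms n \<Longrightarrow> (ga_delta \<sigma> \<star> f) \<pi> = f (inv \<sigma> \<circ> \<pi>)"
  by (simp add: ga_mult_eq_left ga_delta_def if_distrib[of "\<lambda>x. x * _"] cong: if_cong)

lemma ga_delta_mult_right: "\<tau> \<in> Perms n \<Longrightarrow> \<pi> \<in> Perms n \<Longrightarrow> (f \<star> ga_delta \<tau>) \<pi> = f (\<pi> \<circ> inv \<tau>)"
  by (simp add: ga_mult_eq_right ga_delta_def if_distrib[of "\<lambda>x. _ * x"] cong: if_cong)

lemma ga_delta_mult_delta:
  assumes "\<sigma> \<in> Perms n" "\<tau> \<in> Perms n"
  shows "ga_delta \<sigma> \<star> ga_delta \<tau> = ga_delta (\<sigma> \<circ> \<tau>)"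
proof
  fix \<pi>
  show "(ga_delta \<sigma> \<star> ga_delta \<tau>) \<pi> = ga_delta (\<sigma> \<circ> \<tau>) \<pi>"
  proof (cases "\<pi> \<in> Perms n")
    case True
    have "inv \<sigma> \<circ> \<pi> = \<tau> \<longleftrightarrow> \<pi> = \<sigma> \<circ> \<tau>"
      using comp_eq_iff_Perms(1)[OF assms(1), of \<tau> \<pi>] by metis
    with True assms show ?thesis by (simp add: ga_delta_mult_left) (simp add: ga_delta_def)
  next
    case False
    with assms show ?thesis by (auto simp: ga_mult_notin ga_delta_def)
  qed
qed

lemma ga_mult_expand_right: "a \<star> x = (\<lambda>\<pi>. \<Sum>g\<in>Perms n. x g * (a \<star> ga_delta g) \<pi>)"
proof
  fix \<pi>
  show "(a \<star> x) \<pi> = (\<Sum>g\<in>Perms n. x g * (a \<star> ga_delta g) \<pi>)"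
    by (cases "\<pi> \<in> Perms n") (simp_all add: ga_mult_eq_right[of _ a x] ga_delta_mult_right ga_mult_notin mult.commute)
qed

text \<open>Linearity in the middle factor: a statement about \<open>a \<star> x \<star> b\<close>
  has to be checked for group elements x only.\<close>

lemma ga_sandwich_expand: "a \<star> x \<star> b = (\<lambda>\<pi>. \<Sum>g\<in>Perms n. x g * (a \<star> ga_delta g \<star> b) \<pi>)"
  by (subst ga_mult_expand_right[of a x]) (rule ga_mult_sum_left)

lemma ga_sandwich_multiple:
  assumes "\<And>g. g \<in> Perms n \<Longrightarrow> \<exists>k. a \<star> ga_delta g \<star> b = (\<lambda>\<pi>. k * c \<pi>)"
  obtains k where "a \<star> x \<star> b = (\<lambda>\<pi>. k * c \<pi>)"
proof -
  from assms obtain k where "\<And>g. g \<in> Perms n \<Longrightarrow> a \<star> ga_delta g \<star> b = (\<lambda>\<pi>. k g * c \<pi>)" by metis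
  then have "a \<star> x \<star> b = (\<lambda>\<pi>. (\<Sum>g\<in>Perms n. x g * k g) * c \<pi>)"
    by (simp add: ga_sandwich_expand[of a x b] sum_distrib_right mult.assoc)
  then show ?thesis by (rule that)
qed

lemma ga_adj_mult: "ga_adj n (f \<star> g) = ga_adj n g \<star> ga_adj n f"
proof
  fix \<pi>
  show "ga_adj n (f \<star> g) \<pi> = (ga_adj n g \<star> ga_adj n f) \<pi>"
  proof (cases "\<pi> \<in> Perms n")
    case True
    have "(ga_adj n g \<star> ga_adj n f) \<pi> = (\<Sum>\<tau>\<in>Perms n. cnj (g (inv (\<pi> \<circ> inv \<tau>))) * cnj (f (inv \<tau>)))"
      using True by (simp add: ga_mult_eq_right) (simp add: ga_adj_def comp_in_Perms inv_in_Perms)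
    also have "\<dots> = (\<Sum>\<tau>\<in>Perms n. cnj (g (inv (inv \<tau>) \<circ> inv \<pi>)) * cnj (f (inv \<tau>)))"
      using True by (intro sum.cong refl) (simp add: o_inv_distrib bij_Perms bij_imp_bij_inv)
    also have "\<dots> = (\<Sum>\<tau>\<in>Perms n. cnj (g (inv \<tau> \<circ> inv \<pi>)) * cnj (f \<tau>))"
      by (rule sum.reindex_bij_betw[OF bij_betw_inv_Perms])
    also have "\<dots> = ga_adj n (f \<star> g) \<pi>"
      using True by (simp add: ga_adj_def ga_mult_eq_left inv_in_Perms mult.commute)
    finally show ?thesis ..
  qed (simp add: ga_adj_def ga_mult_notin)
qed

lemma ga_adj_adj: "f \<in> group_algebra n \<Longrightarrow> ga_adj n (ga_adj n f) = f"
  by (auto simp: ga_adj_def fun_eq_iff inv_in_Perms inv_inv_Perms group_algebraD)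

lemma ga_adj_mult_self_eq_0:
  assumes f: "f \<in> group_algebra n" and "ga_adj n f \<star> f = (\<lambda>_. 0)"
  shows "f = (\<lambda>_. 0)"
proof -
  have "(ga_adj n f \<star> f) id = (\<Sum>\<tau>\<in>Perms n. cnj (f \<tau>) * f \<tau>)"
    by (simp add: ga_mult_eq_right) (simp add: ga_adj_def inv_in_Perms inv_inv_Perms)
  also have "\<dots> = of_real (\<Sum>\<tau>\<in>Perms n. (norm (f \<tau>))\<^sup>2)"
    by (simp only: of_real_sum) (intro sum.cong refl, simp add: complex_norm_square[symmetric] mult.commute del: of_real_power)
  finally have "(\<Sum>\<tau>\<in>Perms n. (norm (f \<tau>))\<^sup>2) = 0"
    using assms(2) by (metis of_real_eq_0_iff)
  then have "\<forall>\<tau>\<in>Perms n. f \<tau> = 0" by (subst (asm) sum_nonneg_eq_0_iff) auto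
  with f show ?thesis by (metis group_algebraD ext)
qed

text \<open>Put z = x^* x, which is its own adjoint. Then z^* z = x^* x x^* x = 0, so z = 0 by
  positivity, and a second use of positivity gives x = 0.\<close>

lemma ga_mult_adj_mult_eq_0:
  assumes x: "x \<in> group_algebra n" and "x \<star> ga_adj n x \<star> x = (\<lambda>_. 0)"
  shows "x = (\<lambda>_. 0)"
proof -
  let ?z = "ga_adj n x \<star> x"
  have "ga_adj n ?z \<star> ?z = ga_adj n x \<star> (x \<star> ga_adj n x \<star> x)"
    using x by (simp add: ga_adj_mult ga_adj_adj ga_mult_assoc)
  then have "ga_adj n ?z \<star> ?z = (\<lambda>_. 0)" by (simp only: assms(2) ga_mult_zero)
  then have "?z = (\<lambda>_. 0)" by (rule ga_adj_mult_self_eq_0[OF ga_mult_in])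
  with x show ?thesis by (rule ga_adj_mult_self_eq_0)
qed

text \<open>A is semiprime, by the case y = x^* of the assumption. Orthogonality, independence of
  the class sums, minimality and injectivity all rest on this.\<close>

lemma ga_sandwich_self_eq_0:
  assumes "x \<in> group_algebra n" and "\<And>y. x \<star> y \<star> x = (\<lambda>_. 0)"
  shows "x = (\<lambda>_. 0)"
  using assms(1) assms(2) by (rule ga_mult_adj_mult_eq_0)

end

section \<open>Young tableaux\<close>

text \<open>Cells are numbered row by row from 0, as in \<open>tab_row\<close> and
  \<open>tab_col\<close>; the description is meaningful only for
  \<open>x < sum_list \<nu>\<close>.\<close>

definition tab_pos :: "nat list \<Rightarrow> nat \<Rightarrow> nat \<times> nat" where
  "tab_pos \<nu> x = (THE (r, c). r < length \<nu> \<and> c < \<nu> ! r \<and> x = sum_list (take r \<nu>) + c)"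

definition row_of :: "nat list \<Rightarrow> nat \<Rightarrow> nat" where
  "row_of \<nu> x = fst (tab_pos \<nu> x)"

definition col_of :: "nat list \<Rightarrow> nat \<Rightarrow> nat" where
  "col_of \<nu> x = snd (tab_pos \<nu> x)"

lemma tab_cell_exists:
  "x < sum_list \<nu> \<Longrightarrow> \<exists>r c. r < length \<nu> \<and> c < \<nu> ! r \<and> x = sum_list (take r \<nu>) + (c :: nat)"
proof (induction \<nu> arbitrary: x)
  case (Cons m \<nu>)
  show ?case
  proof (cases "x < m")
    case True
    then show ?thesis by (intro exI[of _ 0] exI[of _ x]) auto
  next
    case False
    with Cons.prems have "x - m < sum_list \<nu>" by auto
    from Cons.IH[OF this] obtain r c where "r < length \<nu>" "c < \<nu> ! r" "x - m = sum_list (take r \<nu>) + c"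
      by blast
    with False show ?thesis by (intro exI[of _ "Suc r"] exI[of _ c]) auto
  qed
qed simp

lemma tab_cell_unique:
  assumes "r < length \<nu>" "c < \<nu> ! r" "r' < length \<nu>" "c' < \<nu> ! r'"
    and "sum_list (take r \<nu>) + c = sum_list (take r' \<nu>) + (c' :: nat)"
  shows "r = r' \<and> c = c'"
  using assms
proof (induction \<nu> arbitrary: r r')
  case (Cons m \<nu>)
  show ?case
  proof (cases r)
    case 0
    with Cons.prems show ?thesis by (cases r') simp_all
  next
    case (Suc k)
    show ?thesis
    proof (cases r')
      case 0
      with Cons.prems Suc show ?thesis by simp
    next
      case (Suc k')
      then show ?thesis using Cons.prems \<open>r = Suc k\<close> Cons.IH[of k k'] by simp
    qed
  qed
qed simp

lemma tab_cell_less: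
  "r < length \<nu> \<Longrightarrow> c < \<nu> ! r \<Longrightarrow> sum_list (take r \<nu>) + c < sum_list (\<nu> :: nat list)"
proof (induction \<nu> arbitrary: r)
  case (Cons m \<nu>)
  then show ?case by (cases r) (auto intro: add_strict_left_mono simp: add.assoc)
qed simp

lemma tab_pos_cell:
  assumes "r < length \<nu>" "c < \<nu> ! r"
  shows "tab_pos \<nu> (sum_list (take r \<nu>) + c) = (r, c)"
  unfolding tab_pos_def
proof (rule the_equality)
  show "case (r, c) of (r', c') \<Rightarrow> r' < length \<nu> \<and> c' < \<nu> ! r' \<and>
      sum_list (take r \<nu>) + c = sum_list (take r' \<nu>) + c'"
    using assms by simp
next
  fix p assume "case p of (r', c') \<Rightarrow> r' < length \<nu> \<and> c' < \<nu> ! r' \<and>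
      sum_list (take r \<nu>) + c = sum_list (take r' \<nu>) + c'"
  then show "p = (r, c)" using assms tab_cell_unique[of r \<nu> c "fst p" "snd p"] by (auto split: prod.splits)
qed

lemma row_of_cell: "r < length \<nu> \<Longrightarrow> c < \<nu> ! r \<Longrightarrow> row_of \<nu> (sum_list (take r \<nu>) + c) = r"
  and col_of_cell: "r < length \<nu> \<Longrightarrow> c < \<nu> ! r \<Longrightarrow> col_of \<nu> (sum_list (take r \<nu>) + c) = c"
  by (simp_all add: row_of_def col_of_def tab_pos_cell)

lemma cell_of_pos:
  assumes "x < sum_list \<nu>"
  shows "row_of \<nu> x < length \<nu>" "col_of \<nu> x < \<nu> ! row_of \<nu> x"
    "sum_list (take (row_of \<nu> x) \<nu>) + col_of \<nu> x = x"
  using tab_cell_exists[OF assms] by (auto simp: row_of_cell col_of_cell)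

lemma row_col_inj:
  assumes "x < sum_list \<nu>" "y < sum_list \<nu>" "row_of \<nu> x = row_of \<nu> y" "col_of \<nu> x = col_of \<nu> y"
  shows "x = y"
  using assms cell_of_pos(3) by metis

lemma tab_row_eq:
  assumes "r < length \<nu>"
  shows "tab_row \<nu> r = {x. x < sum_list \<nu> \<and> row_of \<nu> x = r}"
proof -
  have "sum_list (take (Suc r) \<nu>) = sum_list (take r \<nu>) + \<nu> ! r"
    using assms by (simp add: take_Suc_conv_app_nth)
  then have "x \<in> tab_row \<nu> r \<longleftrightarrow> (\<exists>c<\<nu> ! r. x = sum_list (take r \<nu>) + c)" for x
    unfolding tab_row_def
    by (auto intro: exI[of _ "x - sum_list (take r \<nu>)"])
  moreover have "(\<exists>c<\<nu> ! r. x = sum_list (take r \<nu>) + c) \<longleftrightarrow> x < sum_list \<nu> \<and> row_of \<nu> x = r" for x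
    using assms cell_of_pos[of x \<nu>] by (metis row_of_cell tab_cell_less)
  ultimately show ?thesis by blast
qed

lemma tab_col_eq: "tab_col \<nu> c = {x. x < sum_list \<nu> \<and> col_of \<nu> x = c}"
proof -
  have "x \<in> tab_col \<nu> c \<longleftrightarrow> x < sum_list \<nu> \<and> col_of \<nu> x = c" for x
    unfolding tab_col_def mem_Collect_eq using cell_of_pos[of x \<nu>] by (metis col_of_cell tab_cell_less)
  then show ?thesis by blast
qed

lemma Perms_image_eqI:
  assumes "p \<in> Perms n" "A \<subseteq> {..<n}" "p ` A \<subseteq> A"
  shows "p ` A = A"
  using assms by (intro endo_inj_surj) (auto intro: finite_subset inj_on_subset[OF bij_is_inj[OF bij_Perms]])

text \<open>Replaces the stabilising of each row as a set by a condition on single points.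
  Conversely a row mapped into itself is mapped onto itself, being finite.\<close>

lemma mem_row_group:
  assumes "sum_list \<nu> = n"
  shows "p \<in> row_group n \<nu> \<longleftrightarrow> p \<in> Perms n \<and> (\<forall>x<n. row_of \<nu> (p x) = row_of \<nu> x)"
proof safe
  assume p: "p \<in> row_group n \<nu>"
  then show "p \<in> Perms n" unfolding row_group_def by blast
  fix x assume x: "x < n"
  have r: "row_of \<nu> x < length \<nu>" using x assms cell_of_pos by simp
  have "p ` tab_row \<nu> (row_of \<nu> x) = tab_row \<nu> (row_of \<nu> x)" using p r unfolding row_group_def by blast
  then have "p x \<in> tab_row \<nu> (row_of \<nu> x)" using x r assms by (auto simp: tab_row_eq)
  then show "row_of \<nu> (p x) = row_of \<nu> x" using r by (simp add: tab_row_eq)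
next
  assume p: "p \<in> Perms n" "\<forall>x<n. row_of \<nu> (p x) = row_of \<nu> x"
  have "p ` tab_row \<nu> r = tab_row \<nu> r" if "r < length \<nu>" for r
    using p assms that by (intro Perms_image_eqI[of p n]) (auto simp: tab_row_eq Perms_less)
  with p show "p \<in> row_group n \<nu>" unfolding row_group_def by blast
qed

lemma mem_col_group:
  assumes "sum_list \<nu> = n"
  shows "p \<in> col_group n \<nu> \<longleftrightarrow> p \<in> Perms n \<and> (\<forall>x<n. col_of \<nu> (p x) = col_of \<nu> x)"
proof safe
  assume p: "p \<in> col_group n \<nu>"
  then show "p \<in> Perms n" unfolding col_group_def by blast
  fix x assume x: "x < n"
  have "p ` tab_col \<nu> (col_of \<nu> x) = tab_col \<nu> (col_of \<nu> x)" using p unfolding col_group_def by blast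
  then have "p x \<in> tab_col \<nu> (col_of \<nu> x)" using x assms by (auto simp: tab_col_eq)
  then show "col_of \<nu> (p x) = col_of \<nu> x" by (simp add: tab_col_eq)
next
  assume p: "p \<in> Perms n" "\<forall>x<n. col_of \<nu> (p x) = col_of \<nu> x"
  have "p ` tab_col \<nu> c = tab_col \<nu> c" for c
    using p assms by (intro Perms_image_eqI[of p n]) (auto simp: tab_col_eq Perms_less)
  with p show "p \<in> col_group n \<nu>" unfolding col_group_def by blast
qed

section \<open>Comparing tableaux by sums of row indices\<close>

lemma finite_down_closed_nat:
  fixes S :: "nat set"
  assumes "finite S" "\<And>x y. x \<in> S \<Longrightarrow> y < x \<Longrightarrow> y \<in> S"
  shows "S = {..<card S}"
proof -
  define m where "m = (LEAST k. k \<notin> S)"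
  have "\<exists>k. k \<notin> S" using assms(1) by (meson ex_new_if_finite infinite_UNIV_nat)
  then have "m \<notin> S" unfolding m_def by (rule LeastI_ex)
  moreover have "k \<in> S" if "k < m" for k using that not_less_Least unfolding m_def by blast
  ultimately have "S = {..<m}" using assms(2) by (metis lessThan_iff linorder_neqE_nat subset_antisym subsetI)
  then show ?thesis by simp
qed

text \<open>Induction by removing the maximum: k + 1 distinct natural numbers have maximum at least
  k, and equality of the sums forces it to be k.\<close>

lemma sum_nat_set_minimal:
  fixes S :: "nat set"
  assumes "finite S"
  shows "\<Sum>{..<card S} \<le> \<Sum>S \<and> (\<Sum>S \<le> \<Sum>{..<card S} \<longrightarrow> S = {..<card S})"
  using assms
proof (induction "card S" arbitrary: S)
  case (Suc k)
  define M where "M = Max S"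
  have M: "M \<in> S" "\<And>x. x \<in> S \<Longrightarrow> x \<le> M" using Suc.hyps(2) Suc.prems
    unfolding M_def by (metis Max_in card.empty nat.distinct(1)) (simp add: Suc.prems)
  have k: "k = card (S - {M})" using Suc.hyps(2) Suc.prems M(1) by simp
  have IH: "\<Sum>{..<k} \<le> \<Sum>(S - {M})" "\<Sum>(S - {M}) \<le> \<Sum>{..<k} \<Longrightarrow> S - {M} = {..<k}"
    using Suc.hyps(1)[OF k finite_Diff[OF Suc.prems], folded k] by blast+
  have "card S \<le> card {..M}" using M(2) by (intro card_mono) auto
  then have kM: "k \<le> M" using Suc.hyps(2) by simp
  have S: "\<Sum>S = M + \<Sum>(S - {M})" using Suc.prems M(1) by (simp add: sum.remove)
  have T: "\<Sum>{..<card S} = k + \<Sum>{..<k}" using Suc.hyps(2)[symmetric] by (simp add: lessThan_Suc)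
  show ?case
  proof (intro conjI impI)
    show "\<Sum>{..<card S} \<le> \<Sum>S" using IH(1) kM S T by linarith
  next
    assume "\<Sum>S \<le> \<Sum>{..<card S}"
    then have "M = k" "\<Sum>(S - {M}) \<le> \<Sum>{..<k}" using IH(1) kM S T by linarith+
    then have "S - {M} = {..<k}" by (intro IH(2))
    then have "S = {..<Suc k}" using \<open>M = k\<close> M(1) by (metis insert_Diff lessThan_Suc)
    then show "S = {..<card S}" by (metis card_lessThan)
  qed
qed simp

text \<open>Rows are weakly decreasing in length, so a cell of column c in some row puts one into
  every earlier row: a column fills an initial segment of the rows.\<close>

lemma row_of_image_col:
  assumes "\<mu> \<in> partitions n"
  shows "row_of \<mu> ` {y. y < n \<and> col_of \<mu> y = c} = {..<card {y. y < n \<and> col_of \<mu> y = c}}"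
    and "inj_on (row_of \<mu>) {y. y < n \<and> col_of \<mu> y = c}"
proof -
  let ?K = "{y. y < n \<and> col_of \<mu> y = c}"
  have n: "sum_list \<mu> = n" and srt: "sorted_wrt (\<ge>) \<mu>" using assms unfolding partitions_def by auto
  show inj: "inj_on (row_of \<mu>) ?K" using n row_col_inj[of _ \<mu>] by (intro inj_onI) simp
  have "y \<in> row_of \<mu> ` ?K" if "x \<in> row_of \<mu> ` ?K" "y < x" for x y
  proof -
    from that obtain z where z: "z < n" "col_of \<mu> z = c" "x = row_of \<mu> z" by blast
    then have x: "x < length \<mu>" "c < \<mu> ! x" using cell_of_pos[of z \<mu>] n by auto
    have "\<mu> ! x \<le> \<mu> ! y" using srt that(2) x(1) by (auto simp: sorted_wrt_iff_nth_less)
    then have y: "y < length \<mu>" "c < \<mu> ! y" using x that(2) by auto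
    show ?thesis using tab_cell_less[OF y] row_of_cell[OF y] col_of_cell[OF y] n
      by (intro image_eqI[of _ _ "sum_list (take y \<mu>) + c"]) auto
  qed
  then have "row_of \<mu> ` ?K = {..<card (row_of \<mu> ` ?K)}" by (intro finite_down_closed_nat) auto
  then show "row_of \<mu> ` ?K = {..<card ?K}" by (simp add: card_image[OF inj])
qed

lemma partition_eqI:
  assumes "\<nu> \<in> partitions n" "\<mu> \<in> partitions n"
    and eq: "\<And>r. card {x. x < n \<and> row_of \<nu> x = r} = card {x. x < n \<and> row_of \<mu> x = r}"
  shows "\<nu> = \<mu>"
proof -
  have card: "card {x. x < n \<and> row_of \<kappa> x = r} = (if r < length \<kappa> then \<kappa> ! r else 0)"
    if "\<kappa> \<in> partitions n" for \<kappa> r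
  proof (cases "r < length \<kappa>")
    case True
    have "{x. x < n \<and> row_of \<kappa> x = r} = tab_row \<kappa> r"
      using True that by (simp add: tab_row_eq partitions_def)
    then show ?thesis using True by (simp add: tab_row_def take_Suc_conv_app_nth)
  next
    case False
    then have "{x. x < n \<and> row_of \<kappa> x = r} = {}" using cell_of_pos(1)[of _ \<kappa>] that
      by (auto simp: partitions_def)
    then show ?thesis using False by (simp only: card.empty if_False)
  qed
  \<comment> \<open>Parts are nonzero, so the rows that contain cells are exactly those below the
    length; this recovers the length from the row counts.\<close>
  have pos: "\<kappa> ! r \<noteq> 0" if "\<kappa> \<in> partitions n" "r < length \<kappa>" for \<kappa> r
    using that nth_mem[OF that(2)] unfolding partitions_def mem_Collect_eq by metis
  have e: "(if r < length \<nu> then \<nu> ! r else 0) = (if r < length \<mu> then \<mu> ! r else 0)" for r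
    using eq[of r] card assms(1,2) by simp
  have "r < length \<nu> \<longleftrightarrow> r < length \<mu>" for r
    using e[of r] pos[OF assms(1), of r] pos[OF assms(2), of r] by (auto split: if_splits)
  then have len: "length \<nu> = length \<mu>" by (metis linorder_neqE_nat less_irrefl)
  show ?thesis using len e by (auto intro!: nth_equalityI) metis
qed

text \<open>The sum of the row indices of a tableau replaces the dominance order: a column of length
  \<open>m\<close> that meets every row of the other tableau at most once contributes at least
  \<open>0 + 1 + \<dots> + (m - 1)\<close>, with equality only if it occupies the first \<open>m\<close> rows.\<close>

lemma transversal_columns:
  assumes \<nu>: "\<nu> \<in> partitions n" and \<mu>: "\<mu> \<in> partitions n" and g: "g \<in> Perms n"
    and inj: "\<And>x y. x < n \<Longrightarrow> y < n \<Longrightarrow> row_of \<nu> x = row_of \<nu> y \<Longrightarrow>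
                 col_of \<mu> (inv g x) = col_of \<mu> (inv g y) \<Longrightarrow> x = y"
    and le: "(\<Sum>x<n. row_of \<nu> x) \<le> (\<Sum>x<n. row_of \<mu> x)"
  shows "\<nu> = \<mu>" and "\<exists>\<rho>\<in>row_group n \<nu>. \<rho> \<circ> g \<in> col_group n \<nu>"
proof -
  have n\<nu>: "sum_list \<nu> = n" and n\<mu>: "sum_list \<mu> = n" using \<nu> \<mu> unfolding partitions_def by auto
  \<comment> \<open>\<open>F x\<close> is the column of x in the tableau of shape \<mu> whose
    entries are relabelled by g, and \<open>G c\<close> is column c of that tableau;
    \<open>K c\<close> is the same column before relabelling.\<close>
  define F where "F = (\<lambda>x. col_of \<mu> (inv g x))"
  define G where "G c = {x. x < n \<and> F x = c}" for c
  define K where "K c = {y. y < n \<and> col_of \<mu> y = c}" for c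
  have fin: "finite (G c)" "finite (K c)" for c unfolding G_def K_def by auto
  define C where "C = col_of \<mu> ` {..<n}"
  have GK: "bij_betw g (K c) (G c)" for c
    unfolding G_def K_def F_def using g
    by (intro bij_betw_byWitness[where f' = "inv g"]) (auto simp: comp_inv_Perms Perms_less inv_in_Perms)
  then have cardGK: "card (G c) = card (K c)" for c using bij_betw_same_card by metis
  have FC: "F ` {..<n} \<subseteq> C" unfolding F_def C_def using g by (auto simp: Perms_less inv_in_Perms)
  have injG: "inj_on (row_of \<nu>) (G c)" for c
    unfolding G_def F_def by (intro inj_onI) (auto intro: inj)
  have sG: "(\<Sum>x<n. row_of \<nu> x) = (\<Sum>c\<in>C. \<Sum>x\<in>G c. row_of \<nu> x)"
    using sum.group[of "{..<n}" C F "row_of \<nu>"] FC unfolding C_def G_def by simp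
  have sK: "(\<Sum>x<n. row_of \<mu> x) = (\<Sum>c\<in>C. \<Sum>x\<in>K c. row_of \<mu> x)"
    using sum.group[of "{..<n}" C "col_of \<mu>" "row_of \<mu>"] unfolding C_def K_def by simp
  have imK: "row_of \<mu> ` K c = {..<card (K c)}" for c
    unfolding K_def by (rule row_of_image_col(1)[OF \<mu>])
  have sumK: "(\<Sum>x\<in>K c. row_of \<mu> x) = \<Sum>{..<card (K c)}" for c
    using sum.reindex[of "row_of \<mu>" "K c" id] row_of_image_col(2)[OF \<mu>, of c] imK[of c]
    by (simp add: K_def)
  have sumG: "(\<Sum>x\<in>G c. row_of \<nu> x) = \<Sum>(row_of \<nu> ` G c)" for c
    using sum.reindex[OF injG[of c], of id] by simp
  have cim: "card (row_of \<nu> ` G c) = card (K c)" for c using card_image[OF injG] cardGK by simp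
  have ge: "(\<Sum>x\<in>K c. row_of \<mu> x) \<le> (\<Sum>x\<in>G c. row_of \<nu> x)" for c
    using sum_nat_set_minimal[of "row_of \<nu> ` G c"] fin unfolding sumK sumG cim by simp
  \<comment> \<open>Each column has \<nu>-row sum at least its \<mu>-row sum, while
    \<open>le\<close> bounds the totals the other way. Hence every column attains the minimum, and
    \<open>G c\<close> occupies the same initial rows of \<nu> as \<open>K c\<close> does of
    \<mu>.\<close>
  have "(\<Sum>c\<in>C. \<Sum>x\<in>K c. row_of \<mu> x) = (\<Sum>c\<in>C. \<Sum>x\<in>G c. row_of \<nu> x)"
    using le sG sK sum_mono[of C "\<lambda>c. \<Sum>x\<in>K c. row_of \<mu> x", OF ge] by linarith
  then have "(\<Sum>x\<in>K c. row_of \<mu> x) = (\<Sum>x\<in>G c. row_of \<nu> x)" if "c \<in> C" for c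
    using sum_mono_inv[of "\<lambda>c. \<Sum>x\<in>K c. row_of \<mu> x" C] ge that unfolding C_def by blast
  then have imG: "row_of \<nu> ` G c = row_of \<mu> ` K c" if "c \<in> C" for c
    using sum_nat_set_minimal[of "row_of \<nu> ` G c"] fin that unfolding sumK sumG cim imK by simp
  \<comment> \<open>So \<mu> has a cell in row \<open>row_of \<nu> x\<close> and column
    \<open>F x\<close>. Sending x there preserves rows; since \<open>F (g x)\<close> is the
    \<mu>-column of x, the map composed with g preserves columns.\<close>
  have "\<exists>y<n. row_of \<mu> y = row_of \<nu> x \<and> col_of \<mu> y = F x" if "x < n" for x
  proof -
    have "row_of \<nu> x \<in> row_of \<nu> ` G (F x)" using that unfolding G_def by blast
    moreover have "F x \<in> C" using FC that by blast
    ultimately have "row_of \<nu> x \<in> row_of \<mu> ` K (F x)" using imG by blast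
    then show ?thesis unfolding K_def by force
  qed
  then obtain \<rho>0 where \<rho>0: "\<And>x. x < n \<Longrightarrow> \<rho>0 x < n \<and> row_of \<mu> (\<rho>0 x) = row_of \<nu> x \<and> col_of \<mu> (\<rho>0 x) = F x"
    by metis
  define \<rho> where "\<rho> x = (if x < n then \<rho>0 x else x)" for x
  have inj\<rho>: "inj_on \<rho> {..<n}"
    using \<rho>0 unfolding \<rho>_def F_def by (intro inj_onI) (metis inj lessThan_iff)
  have "\<rho> ` {..<n} = {..<n}" using \<rho>0 inj\<rho> by (intro endo_inj_surj) (auto simp: \<rho>_def)
  then have "bij_betw \<rho> {..<n} {..<n}" using inj\<rho> unfolding bij_betw_def by simp
  then have \<rho>: "\<rho> \<in> Perms n"
    unfolding Perms_def mem_Collect_eq by (rule bij_imp_permutes) (simp add: \<rho>_def)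
  have \<rho>_row: "row_of \<mu> (\<rho> x) = row_of \<nu> x" and \<rho>_col: "col_of \<mu> (\<rho> x) = F x" if "x < n" for x
    using \<rho>0 that by (simp_all add: \<rho>_def)
  have inv_\<rho>_row: "row_of \<nu> (inv \<rho> x) = row_of \<mu> x" if "x < n" for x
    using \<rho>_row[of "inv \<rho> x"] \<rho> that by (simp add: Perms_less inv_in_Perms comp_inv_Perms)
  have "bij_betw \<rho> {x. x < n \<and> row_of \<nu> x = r} {x. x < n \<and> row_of \<mu> x = r}" for r
    using \<rho> by (intro bij_betw_byWitness[where f' = "inv \<rho>"])
      (auto simp: comp_inv_Perms Perms_less inv_in_Perms \<rho>_row inv_\<rho>_row)
  then show eq: "\<nu> = \<mu>" using bij_betw_same_card by (intro partition_eqI[OF \<nu> \<mu>]) blast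
  have "\<rho> \<in> row_group n \<nu>" using \<rho> \<rho>_row eq n\<nu> by (simp add: mem_row_group)
  moreover have "\<rho> \<circ> g \<in> col_group n \<nu>"
    using \<rho> \<rho>_col eq n\<nu> g by (auto simp: mem_col_group Perms_less F_def comp_inv_Perms)
  ultimately show "\<exists>\<rho>\<in>row_group n \<nu>. \<rho> \<circ> g \<in> col_group n \<nu>" by blast
qed

section \<open>Young symmetrizers\<close>

text \<open>The factor a_\<nu> of the overview; \<open>col_alt\<close> is b_\<nu>.\<close>

definition row_sym :: "nat \<Rightarrow> nat list \<Rightarrow> galg" where
  "row_sym n \<nu> = (\<lambda>p. if p \<in> row_group n \<nu> then 1 else 0)"

definition col_alt :: "nat \<Rightarrow> nat list \<Rightarrow> galg" where
  "col_alt n \<nu> = (\<lambda>p. if p \<in> col_group n \<nu> then of_int (sign p) else 0)"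

lemma young_symmetrizer_eq: "young_symmetrizer n \<nu> = ga_mult n (row_sym n \<nu>) (col_alt n \<nu>)"
  unfolding young_symmetrizer_def row_sym_def col_alt_def ..

lemma permutation_Perms: "p \<in> Perms n \<Longrightarrow> permutation p"
  unfolding Perms_def permutation_permutes by blast

lemma partitions_sum_list: "\<nu> \<in> partitions n \<Longrightarrow> sum_list \<nu> = n"
  unfolding partitions_def by simp

lemma row_group_Perms: "p \<in> row_group n \<nu> \<Longrightarrow> p \<in> Perms n"
  and col_group_Perms: "p \<in> col_group n \<nu> \<Longrightarrow> p \<in> Perms n"
  unfolding row_group_def col_group_def by blast+

context
  fixes n :: nat and \<nu> :: "nat list"
  assumes \<nu>: "\<nu> \<in> partitions n"
begin

lemma row_group_comp: "p \<in> row_group n \<nu> \<Longrightarrow> q \<in> row_group n \<nu> \<Longrightarrow> p \<circ> q \<in> row_group n \<nu>"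
  using partitions_sum_list[OF \<nu>] by (auto simp: mem_row_group Perms_less)

lemma row_group_inv:
  assumes "p \<in> row_group n \<nu>"
  shows "inv p \<in> row_group n \<nu>"
proof -
  have p: "p \<in> Perms n" "\<And>x. x < n \<Longrightarrow> row_of \<nu> (p x) = row_of \<nu> x"
    using assms partitions_sum_list[OF \<nu>] by (auto simp: mem_row_group)
  have "row_of \<nu> (inv p x) = row_of \<nu> x" if "x < n" for x
    using p(2)[of "inv p x"] that p(1) by (simp add: Perms_less inv_in_Perms comp_inv_Perms)
  then show ?thesis using p(1) partitions_sum_list[OF \<nu>] by (auto simp: mem_row_group)
qed

lemma col_group_comp: "p \<in> col_group n \<nu> \<Longrightarrow> q \<in> col_group n \<nu> \<Longrightarrow> p \<circ> q \<in> col_group n \<nu>"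
  using partitions_sum_list[OF \<nu>] by (auto simp: mem_col_group Perms_less)

lemma col_group_inv:
  assumes "p \<in> col_group n \<nu>"
  shows "inv p \<in> col_group n \<nu>"
proof -
  have p: "p \<in> Perms n" "\<And>x. x < n \<Longrightarrow> col_of \<nu> (p x) = col_of \<nu> x"
    using assms partitions_sum_list[OF \<nu>] by (auto simp: mem_col_group)
  have "col_of \<nu> (inv p x) = col_of \<nu> x" if "x < n" for x
    using p(2)[of "inv p x"] that p(1) by (simp add: Perms_less inv_in_Perms comp_inv_Perms)
  then show ?thesis using p(1) partitions_sum_list[OF \<nu>] by (auto simp: mem_col_group)
qed

lemma row_col_group_id:
  assumes "p \<in> row_group n \<nu>" "p \<in> col_group n \<nu>"
  shows "p = id"
proof
  fix x
  have p: "p \<in> Perms n" using assms(1) by (rule row_group_Perms)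
  show "p x = id x"
  proof (cases "x < n")
    case True
    then show ?thesis using assms p partitions_sum_list[OF \<nu>] row_col_inj[of "p x" \<nu> x]
      by (simp add: mem_row_group mem_col_group Perms_less)
  next
    case False
    with p show ?thesis unfolding Perms_def using permutes_not_in[of p "{..<n}" x] by simp
  qed
qed

lemma row_sym_in: "row_sym n \<nu> \<in> group_algebra n"
  and col_alt_in: "col_alt n \<nu> \<in> group_algebra n"
  unfolding group_algebra_def row_sym_def col_alt_def using row_group_Perms col_group_Perms by auto

lemma row_sym_mult_delta:
  assumes r: "r \<in> row_group n \<nu>"
  shows "ga_mult n (row_sym n \<nu>) (ga_delta r) = row_sym n \<nu>"
proof
  fix \<pi>
  have rP: "r \<in> Perms n" using r by (rule row_group_Perms)
  show "ga_mult n (row_sym n \<nu>) (ga_delta r) \<pi> = row_sym n \<nu> \<pi>"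
  proof (cases "\<pi> \<in> Perms n")
    case True
    have "\<pi> \<circ> inv r \<in> row_group n \<nu> \<longleftrightarrow> \<pi> \<in> row_group n \<nu>"
      using row_group_comp[OF _ row_group_inv[OF r]] row_group_comp[OF _ r] comp_inv_Perms(8)[OF rP]
      by metis
    then show ?thesis using True rP by (simp add: ga_delta_mult_right row_sym_def)
  qed (simp add: ga_mult_notin group_algebraD[OF row_sym_in])
qed

lemma delta_mult_col_alt:
  assumes q: "q \<in> col_group n \<nu>"
  shows "ga_mult n (ga_delta q) (col_alt n \<nu>) = (\<lambda>\<pi>. of_int (sign q) * col_alt n \<nu> \<pi>)"
proof
  fix \<pi>
  have qP: "q \<in> Perms n" using q by (rule col_group_Perms)
  show "ga_mult n (ga_delta q) (col_alt n \<nu>) \<pi> = of_int (sign q) * col_alt n \<nu> \<pi>"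
  proof (cases "\<pi> \<in> Perms n")
    case True
    have "inv q \<circ> \<pi> \<in> col_group n \<nu> \<longleftrightarrow> \<pi> \<in> col_group n \<nu>"
      using col_group_comp[OF col_group_inv[OF q]] col_group_comp[OF q] comp_inv_Perms(5)[OF qP]
      by metis
    moreover have "sign (inv q \<circ> \<pi>) = sign q * sign \<pi>"
      using True qP by (simp add: sign_compose sign_inverse permutation_Perms permutation_inverse)
    ultimately show ?thesis using True qP by (simp add: ga_delta_mult_left col_alt_def)
  qed (simp add: ga_mult_notin group_algebraD[OF col_alt_in])
qed

lemma row_sym_square:
  "ga_mult n (row_sym n \<nu>) (row_sym n \<nu>) = (\<lambda>\<pi>. of_nat (card (row_group n \<nu>)) * row_sym n \<nu> \<pi>)"
proof
  fix \<pi>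
  have "ga_mult n (row_sym n \<nu>) (row_sym n \<nu>) \<pi> =
      (\<Sum>g\<in>Perms n. row_sym n \<nu> g * ga_mult n (row_sym n \<nu>) (ga_delta g) \<pi>)"
    by (subst ga_mult_expand_right) (rule refl)
  also have "\<dots> = (\<Sum>g\<in>row_group n \<nu>. row_sym n \<nu> \<pi>)"
    by (rule sum.mono_neutral_cong_right)
      (auto simp: row_group_Perms row_sym_mult_delta, auto simp: row_sym_def)
  finally show "ga_mult n (row_sym n \<nu>) (row_sym n \<nu>) \<pi> = of_nat (card (row_group n \<nu>)) * row_sym n \<nu> \<pi>"
    by simp
qed

lemma ga_adj_row_sym: "ga_adj n (row_sym n \<nu>) = row_sym n \<nu>"
proof
  fix \<pi>
  have "inv \<pi> \<in> row_group n \<nu> \<longleftrightarrow> \<pi> \<in> row_group n \<nu>" if "\<pi> \<in> Perms n"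
    using row_group_inv inv_inv_Perms[OF that] by metis
  then show "ga_adj n (row_sym n \<nu>) \<pi> = row_sym n \<nu> \<pi>"
    by (auto simp: ga_adj_def row_sym_def dest: row_group_Perms)
qed

lemma ga_adj_col_alt: "ga_adj n (col_alt n \<nu>) = col_alt n \<nu>"
proof
  fix \<pi>
  have "inv \<pi> \<in> col_group n \<nu> \<longleftrightarrow> \<pi> \<in> col_group n \<nu>" if "\<pi> \<in> Perms n"
    using col_group_inv inv_inv_Perms[OF that] by metis
  then show "ga_adj n (col_alt n \<nu>) \<pi> = col_alt n \<nu> \<pi>"
    by (auto simp: ga_adj_def col_alt_def sign_inverse permutation_Perms dest: col_group_Perms)
qed

lemma col_alt_square:
  "ga_mult n (col_alt n \<nu>) (col_alt n \<nu>) = (\<lambda>\<pi>. of_nat (card (col_group n \<nu>)) * col_alt n \<nu> \<pi>)"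
proof
  fix \<pi>
  show "ga_mult n (col_alt n \<nu>) (col_alt n \<nu>) \<pi> = of_nat (card (col_group n \<nu>)) * col_alt n \<nu> \<pi>"
  proof (cases "\<pi> \<in> Perms n")
    case True
    have "ga_mult n (col_alt n \<nu>) (col_alt n \<nu>) \<pi> =
        (\<Sum>g\<in>Perms n. col_alt n \<nu> g * ga_mult n (ga_delta g) (col_alt n \<nu>) \<pi>)"
      using True by (simp add: ga_mult_eq_left[of _ _ "col_alt n \<nu>"] ga_delta_mult_left)
    also have "\<dots> = (\<Sum>g\<in>col_group n \<nu>. of_int (sign g * sign g) * col_alt n \<nu> \<pi>)"
      by (rule sum.mono_neutral_cong_right)
        (auto simp: col_group_Perms delta_mult_col_alt simp del: of_int_mult,
          auto simp: col_alt_def simp flip: of_int_mult)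
    finally show ?thesis by simp
  qed (simp add: ga_mult_notin group_algebraD[OF col_alt_in])
qed

text \<open>A row permutation times a column permutation is the identity only if both are, so a
  single product contributes. This is how c_\<nu> is known to be nonzero.\<close>

lemma young_symmetrizer_id: "young_symmetrizer n \<nu> id = 1"
proof -
  have "young_symmetrizer n \<nu> id = (\<Sum>\<sigma>\<in>Perms n. row_sym n \<nu> \<sigma> * col_alt n \<nu> (inv \<sigma>))"
    by (simp add: young_symmetrizer_eq ga_mult_eq_left)
  also have "\<dots> = (\<Sum>\<sigma>\<in>{id}. row_sym n \<nu> \<sigma> * col_alt n \<nu> (inv \<sigma>))"
  proof (rule sum.mono_neutral_right)
    show "\<forall>\<sigma>\<in>Perms n - {id}. row_sym n \<nu> \<sigma> * col_alt n \<nu> (inv \<sigma>) = 0"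
    proof
      fix \<sigma> assume \<sigma>: "\<sigma> \<in> Perms n - {id}"
      then have "\<not> (\<sigma> \<in> row_group n \<nu> \<and> inv \<sigma> \<in> col_group n \<nu>)"
        using row_col_group_id[of \<sigma>] col_group_inv[of "inv \<sigma>"] inv_inv_Perms[of \<sigma> n] by auto
      then show "row_sym n \<nu> \<sigma> * col_alt n \<nu> (inv \<sigma>) = 0" by (auto simp: row_sym_def col_alt_def)
    qed
  qed auto
  also have "\<dots> = 1"
    using partitions_sum_list[OF \<nu>] by (simp add: row_sym_def col_alt_def mem_row_group mem_col_group sign_id)
  finally show ?thesis .
qed

end

section \<open>Products of row symmetrizers and column antisymmetrizers\<close>

lemma row_sym_delta_col_alt_eq_0:
  assumes \<nu>: "\<nu> \<in> partitions n" and \<mu>: "\<mu> \<in> partitions n" and g: "g \<in> Perms n"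
    and x: "x < n" "y < n" "x \<noteq> y" "row_of \<nu> x = row_of \<nu> y"
      "col_of \<mu> (inv g x) = col_of \<mu> (inv g y)"
  shows "ga_mult n (ga_mult n (row_sym n \<nu>) (ga_delta g)) (col_alt n \<mu>) = (\<lambda>_. 0)"
    (is "?z = _")
proof -
  \<comment> \<open>The transposition t preserves the rows of \<nu>, and its conjugate s by the
    inverse of g preserves the columns of \<mu>. Moving t through g gives a g b = a t g b = a g s b
    = - a g b.\<close>
  define t where "t = transpose x y"
  define s where "s = transpose (inv g x) (inv g y)"
  have less: "inv g x < n" "inv g y < n" using g x by (simp_all add: Perms_less inv_in_Perms)
  have tP: "t \<in> Perms n" and sP: "s \<in> Perms n"
    unfolding t_def s_def Perms_def using x less by (auto intro!: permutes_swap_id)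
  have t: "t \<in> row_group n \<nu>"
    using tP x partitions_sum_list[OF \<nu>] by (auto simp: mem_row_group t_def transpose_def)
  have s: "s \<in> col_group n \<mu>"
    using sP x partitions_sum_list[OF \<mu>] by (auto simp: mem_col_group s_def transpose_def)
  have "inv g x \<noteq> inv g y" using x(3) comp_inv_Perms(3)[OF g] by metis
  then have sgn: "sign s = -1" unfolding s_def by (simp add: sign_swap_id)
  have ts: "t \<circ> g = g \<circ> s"
  proof
    fix z
    have "g z = x \<longleftrightarrow> z = inv g x" "g z = y \<longleftrightarrow> z = inv g y" using comp_inv_Perms(3,4)[OF g] by metis+
    then show "(t \<circ> g) z = (g \<circ> s) z" by (auto simp: t_def s_def transpose_def comp_inv_Perms[OF g])
  qed
  have "?z = ga_mult n (ga_mult n (ga_mult n (row_sym n \<nu>) (ga_delta t)) (ga_delta g)) (col_alt n \<mu>)"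
    by (simp add: row_sym_mult_delta[OF \<nu> t])
  also have "\<dots> = ga_mult n (ga_mult n (row_sym n \<nu>) (ga_delta (t \<circ> g))) (col_alt n \<mu>)"
    by (simp only: ga_mult_assoc ga_delta_mult_delta[OF tP g])
  also have "\<dots> = ga_mult n (ga_mult n (row_sym n \<nu>) (ga_delta g)) (ga_mult n (ga_delta s) (col_alt n \<mu>))"
    by (simp only: ga_mult_assoc ts ga_delta_mult_delta[OF g sP, symmetric])
  also have "\<dots> = (\<lambda>\<pi>. - ?z \<pi>)"
    unfolding delta_mult_col_alt[OF \<mu> s] ga_mult_scale_right sgn by simp
  finally have "?z \<pi> = - ?z \<pi>" for \<pi> by (rule fun_cong)
  then show ?thesis by (simp add: fun_eq_iff)
qed

text \<open>A group element without a pair as in \<open>row_sym_delta_col_alt_eq_0\<close> satisfies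
  the injectivity assumption of \<open>transversal_columns\<close>, and \<open>le\<close> would then
  make the shapes equal.\<close>

lemma row_sym_col_alt_orthogonal:
  assumes \<nu>: "\<nu> \<in> partitions n" and \<mu>: "\<mu> \<in> partitions n" and "\<nu> \<noteq> \<mu>"
    and le: "(\<Sum>x<n. row_of \<nu> x) \<le> (\<Sum>x<n. row_of \<mu> x)"
  shows "ga_mult n (ga_mult n (row_sym n \<nu>) x) (col_alt n \<mu>) = (\<lambda>_. 0)"
proof -
  have "ga_mult n (ga_mult n (row_sym n \<nu>) (ga_delta g)) (col_alt n \<mu>) = (\<lambda>_. 0)" if "g \<in> Perms n" for g
    using row_sym_delta_col_alt_eq_0[OF \<nu> \<mu> that] transversal_columns(1)[OF \<nu> \<mu> that _ le] \<open>\<nu> \<noteq> \<mu>\<close> by blast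
  then show ?thesis by (simp add: ga_sandwich_expand[of n _ x])
qed

text \<open>For a group element g, either a pair sharing a row and a column makes the product
  vanish, or g is a row permutation times a column permutation and the product is c_\<nu> up to the
  sign of the latter.\<close>

lemma row_sym_col_alt_multiple:
  assumes \<nu>: "\<nu> \<in> partitions n"
  obtains k where "ga_mult n (ga_mult n (row_sym n \<nu>) x) (col_alt n \<nu>) = (\<lambda>\<pi>. k * young_symmetrizer n \<nu> \<pi>)"
proof -
  have "\<exists>k. ga_mult n (ga_mult n (row_sym n \<nu>) (ga_delta g)) (col_alt n \<nu>) =
      (\<lambda>\<pi>. k * young_symmetrizer n \<nu> \<pi>)" if g: "g \<in> Perms n" for g
  proof (cases "\<exists>x y. x < n \<and> y < n \<and> x \<noteq> y \<and> row_of \<nu> x = row_of \<nu> y \<and>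
      col_of \<nu> (inv g x) = col_of \<nu> (inv g y)")
    case True
    then have "ga_mult n (ga_mult n (row_sym n \<nu>) (ga_delta g)) (col_alt n \<nu>) = (\<lambda>_. 0)"
      using row_sym_delta_col_alt_eq_0[OF \<nu> \<nu> g] by blast
    then show ?thesis by (intro exI[of _ 0]) simp
  next
    case False
    obtain \<rho> where \<rho>: "\<rho> \<in> row_group n \<nu>" and q: "\<rho> \<circ> g \<in> col_group n \<nu>"
      using transversal_columns(2)[OF \<nu> \<nu> g _ order_refl] False by metis
    note \<rho>' = row_group_inv[OF \<nu> \<rho>]
    have "g = inv \<rho> \<circ> (\<rho> \<circ> g)" using row_group_Perms[OF \<rho>] by (simp add: comp_inv_Perms)
    then have "ga_delta g = ga_mult n (ga_delta (inv \<rho>)) (ga_delta (\<rho> \<circ> g))"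
      using ga_delta_mult_delta[OF row_group_Perms[OF \<rho>'] col_group_Perms[OF q]] by simp
    then have "ga_mult n (ga_mult n (row_sym n \<nu>) (ga_delta g)) (col_alt n \<nu>) =
        ga_mult n (ga_mult n (row_sym n \<nu>) (ga_delta (inv \<rho>))) (ga_mult n (ga_delta (\<rho> \<circ> g)) (col_alt n \<nu>))"
      by (simp only: ga_mult_assoc)
    then show ?thesis
      unfolding delta_mult_col_alt[OF \<nu> q] row_sym_mult_delta[OF \<nu> \<rho>'] ga_mult_scale_right
        young_symmetrizer_eq by blast
  qed
  then show ?thesis using ga_sandwich_multiple[of n "row_sym n \<nu>" "col_alt n \<nu>"] that by metis
qed

lemma young_symmetrizer_in [simp]: "young_symmetrizer n \<nu> \<in> group_algebra n"
  unfolding young_symmetrizer_eq by simp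

lemma young_symmetrizer_sandwich:
  assumes "\<nu> \<in> partitions n"
  obtains k where "ga_mult n (ga_mult n (young_symmetrizer n \<nu>) x) (young_symmetrizer n \<nu>) =
    (\<lambda>\<pi>. k * young_symmetrizer n \<nu> \<pi>)"
proof -
  have "ga_mult n (ga_mult n (young_symmetrizer n \<nu>) x) (young_symmetrizer n \<nu>) =
    ga_mult n (ga_mult n (row_sym n \<nu>) (ga_mult n (col_alt n \<nu>) (ga_mult n x (row_sym n \<nu>)))) (col_alt n \<nu>)"
    unfolding young_symmetrizer_eq by (simp only: ga_mult_assoc)
  then show ?thesis using row_sym_col_alt_multiple[OF assms] that by metis
qed

lemma young_symmetrizer_orthogonal:
  assumes \<nu>: "\<nu> \<in> partitions n" and \<mu>: "\<mu> \<in> partitions n" and "\<nu> \<noteq> \<mu>"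
  shows "ga_mult n (ga_mult n (young_symmetrizer n \<nu>) x) (young_symmetrizer n \<mu>) = (\<lambda>_. 0)"
proof -
  have *: "ga_mult n (ga_mult n (young_symmetrizer n \<kappa>) x) (young_symmetrizer n \<kappa>') = (\<lambda>_. 0)"
    if "\<kappa> \<in> partitions n" "\<kappa>' \<in> partitions n" "\<kappa> \<noteq> \<kappa>'"
      "(\<Sum>x<n. row_of \<kappa> x) \<le> (\<Sum>x<n. row_of \<kappa>' x)" for \<kappa> \<kappa>' x
  proof -
    have "ga_mult n (ga_mult n (young_symmetrizer n \<kappa>) x) (young_symmetrizer n \<kappa>') =
      ga_mult n (ga_mult n (row_sym n \<kappa>) (ga_mult n (col_alt n \<kappa>) (ga_mult n x (row_sym n \<kappa>')))) (col_alt n \<kappa>')"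
      unfolding young_symmetrizer_eq by (simp only: ga_mult_assoc)
    then show ?thesis using row_sym_col_alt_orthogonal[OF that] by simp
  qed
  show ?thesis
  proof (cases "(\<Sum>x<n. row_of \<nu> x) \<le> (\<Sum>x<n. row_of \<mu> x)")
    case True
    with * assms show ?thesis by blast
  next
    case False
    \<comment> \<open>The unfavourable order of the row sums: z y z has a factor in c_\<mu> A
      c_\<nu>, which vanishes by \<open>*\<close>, and semiprimality gives z = 0.\<close>
    let ?z = "ga_mult n (ga_mult n (young_symmetrizer n \<nu>) x) (young_symmetrizer n \<mu>)"
    show ?thesis
    proof (rule ga_sandwich_self_eq_0)
      fix y
      have "ga_mult n (ga_mult n ?z y) ?z =
        ga_mult n (ga_mult n (ga_mult n (young_symmetrizer n \<nu>) x)
          (ga_mult n (ga_mult n (young_symmetrizer n \<mu>) y) (young_symmetrizer n \<nu>)))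
          (ga_mult n x (young_symmetrizer n \<mu>))"
        by (simp only: ga_mult_assoc)
      also have "ga_mult n (ga_mult n (young_symmetrizer n \<mu>) y) (young_symmetrizer n \<nu>) = (\<lambda>_. 0)"
        using * assms False by simp
      finally show "ga_mult n (ga_mult n ?z y) ?z = (\<lambda>_. 0)" by simp
    qed simp
  qed
qed

lemma young_symmetrizer_square:
  assumes \<nu>: "\<nu> \<in> partitions n"
  obtains h where "h \<noteq> 0"
    "ga_mult n (young_symmetrizer n \<nu>) (young_symmetrizer n \<nu>) = (\<lambda>\<pi>. h * young_symmetrizer n \<nu> \<pi>)"
proof -
  let ?a = "row_sym n \<nu>" and ?b = "col_alt n \<nu>" and ?c = "young_symmetrizer n \<nu>"
  obtain h where h: "ga_mult n ?c ?c = (\<lambda>\<pi>. h * ?c \<pi>)"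
  proof -
    have "ga_mult n ?c ?c = ga_mult n (ga_mult n ?a (ga_mult n ?b ?a)) ?b"
      unfolding young_symmetrizer_eq by (simp only: ga_mult_assoc)
    then show ?thesis using row_sym_col_alt_multiple[OF \<nu>] that by metis
  qed
  have "h \<noteq> 0"
  proof
    assume "h = 0"
    \<comment> \<open>Since c = a b and c^* = b a, this is a b b a a b, and the squares of a and b
      contribute only the orders of the two groups.\<close>
    have "ga_mult n (ga_mult n ?c (ga_adj n ?c)) ?c =
        ga_mult n (ga_mult n ?a (ga_mult n ?b ?b)) (ga_mult n (ga_mult n ?a ?a) ?b)"
      unfolding young_symmetrizer_eq ga_adj_mult ga_adj_row_sym[OF \<nu>] ga_adj_col_alt[OF \<nu>]
      by (simp only: ga_mult_assoc)
    also have "\<dots> = (\<lambda>\<pi>. of_nat (card (col_group n \<nu>)) * (of_nat (card (row_group n \<nu>)) * ga_mult n ?c ?c \<pi>))"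
      unfolding row_sym_square[OF \<nu>] col_alt_square[OF \<nu>] ga_mult_scale_left ga_mult_scale_right
      by (simp only: young_symmetrizer_eq)
    also have "\<dots> = (\<lambda>_. 0)" unfolding h \<open>h = 0\<close> by simp
    finally have "?c = (\<lambda>_. 0)" by (intro ga_mult_adj_mult_eq_0[OF young_symmetrizer_in])
    then show False using young_symmetrizer_id[OF \<nu>] by simp
  qed
  with h show ?thesis by (rule that[rotated])
qed

section \<open>Completeness of the Young symmetrizers\<close>

text \<open>Gaussian elimination, with one unknown for each element of \<open>T\<close> and one
  homogeneous equation for each element of \<open>S\<close>.\<close>

lemma exists_linear_dependency:
  fixes F :: "'t \<Rightarrow> 's \<Rightarrow> complex"
  assumes "finite S" "finite T" "card S < card T"
  shows "\<exists>\<beta>. (\<exists>t\<in>T. \<beta> t \<noteq> 0) \<and> (\<forall>s\<in>S. (\<Sum>t\<in>T. \<beta> t * F t s) = 0)"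
  using assms
proof (induction S arbitrary: T F rule: finite_induct)
  case empty
  then have "T \<noteq> {}" by auto
  then show ?case by (intro exI[of _ "\<lambda>_. 1"]) auto
next
  case (insert s S)
  show ?case
  proof (cases "\<forall>t\<in>T. F t s = 0")
    case True
    have "card S < card T" using insert by simp
    from insert.IH[OF insert.prems(1) this] obtain \<beta> where
      "\<exists>t\<in>T. \<beta> t \<noteq> 0" "\<forall>s\<in>S. (\<Sum>t\<in>T. \<beta> t * F t s) = 0" by blast
    with True show ?thesis by (intro exI[of _ \<beta>]) simp
  next
    case False
    then obtain t0 where t0: "t0 \<in> T" "F t0 s \<noteq> 0" by blast
    define T' where "T' = T - {t0}"
    \<comment> \<open>Clears the equation at s with pivot t0; that equation then determines the
      coefficient at t0.\<close>
    define F' where "F' = (\<lambda>t x. F t x - F t s / F t0 s * F t0 x)"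
    have fin: "finite T'" and card: "card S < card T'" using insert t0 by (auto simp: T'_def)
    from insert.IH[OF fin card, of F'] obtain \<beta>' where
      \<beta>': "\<exists>t\<in>T'. \<beta>' t \<noteq> 0" "\<forall>x\<in>S. (\<Sum>t\<in>T'. \<beta>' t * F' t x) = 0" by blast
    define \<beta> where "\<beta> t = (if t = t0 then - (\<Sum>t\<in>T'. \<beta>' t * (F t s / F t0 s)) else \<beta>' t)" for t
    have sum: "(\<Sum>t\<in>T. \<beta> t * F t x) = (\<Sum>t\<in>T'. \<beta>' t * F' t x)" for x
    proof -
      have "(\<Sum>t\<in>T. \<beta> t * F t x) = \<beta> t0 * F t0 x + (\<Sum>t\<in>T'. \<beta> t * F t x)"
        unfolding T'_def using insert.prems(1) t0(1) by (rule sum.remove)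
      also have "(\<Sum>t\<in>T'. \<beta> t * F t x) = (\<Sum>t\<in>T'. \<beta>' t * F t x)"
        by (intro sum.cong refl) (auto simp: \<beta>_def T'_def)
      also have "\<beta> t0 * F t0 x + (\<Sum>t\<in>T'. \<beta>' t * F t x) = (\<Sum>t\<in>T'. \<beta>' t * F' t x)"
        unfolding \<beta>_def F'_def by (simp add: sum_distrib_right right_diff_distrib sum_subtractf mult.assoc)
      finally show ?thesis .
    qed
    have "F' t s = 0" for t using t0 by (simp add: F'_def)
    then have "\<forall>x\<in>insert s S. (\<Sum>t\<in>T. \<beta> t * F t x) = 0" using \<beta>'(2) by (simp add: sum)
    moreover have "\<exists>t\<in>T. \<beta> t \<noteq> 0" using \<beta>'(1) by (auto simp: \<beta>_def T'_def)
    ultimately show ?thesis by blast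
  qed
qed

section \<open>Partitions, cycle types and conjugacy\<close>

lemma finite_partitions: "finite (partitions n)"
proof (rule finite_subset)
  have "length \<nu> \<le> sum_list \<nu>" if "0 \<notin> set \<nu>" for \<nu> :: "nat list"
    using that by (induction \<nu>) auto
  then show "partitions n \<subseteq> {\<nu>. set \<nu> \<subseteq> {..n} \<and> length \<nu> \<le> n}"
    unfolding partitions_def using member_le_sum_list by fastforce
qed (rule finite_lists_length_le, simp)

text \<open>The lists cover \<open>I\<close>, so a fixed point appears as a list of length one;
  hence the lengths add up to the size of \<open>I\<close>.\<close>

definition cycles_of :: "'a set \<Rightarrow> ('a \<Rightarrow> 'a) \<Rightarrow> 'a list list \<Rightarrow> bool" where
  "cycles_of I p css \<longleftrightarrow> distinct (concat css) \<and> set (concat css) = I \<and> [] \<notin> set css \<and>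
     (\<forall>cs\<in>set css. \<forall>x\<in>set cs. p x = cycle_of_list cs x)"

lemma cycle_decomp_cycles_of:
  assumes "cycle_decomp I p"
  shows "p permutes I \<and> (\<exists>css. cycles_of I p css)"
  using assms
proof (induction rule: cycle_decomp.induct)
  case empty
  show ?case by (intro conjI exI[of _ "[]"]) (simp_all add: cycles_of_def id_def)
next
  case (comp I p cs)
  then obtain css where css: "cycles_of I p css" and p: "p permutes I" by blast
  have perm: "cycle_of_list cs \<circ> p permutes set cs \<union> I"
    by (rule permutes_compose[OF permutes_subset[OF p] permutes_subset[OF cycle_permutes]]) auto
  have 1: "(cycle_of_list cs \<circ> p) x = cycle_of_list cs x" if "x \<in> set cs" for x
    using p comp.hyps(3) that by (auto dest: permutes_not_in)
  have 2: "(cycle_of_list cs \<circ> p) x = p x" if "x \<in> I" for x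
    using p comp.hyps(3) that permutes_in_image[OF p, of x] by (auto intro!: id_outside_supp)
  \<comment> \<open>\<open>cycle_decomp\<close> admits an empty cycle, which is the identity and
    must not enter the list of cycles.\<close>
  show ?case
  proof (cases "cs = []")
    case True
    then show ?thesis using css perm by auto
  next
    case False
    have "(cycle_of_list cs \<circ> p) x = cycle_of_list ds x" if "ds \<in> set css" "x \<in> set ds" for ds x
    proof -
      have "x \<in> I" "p x = cycle_of_list ds x" using css that by (auto simp: cycles_of_def)
      then show ?thesis using 2 by metis
    qed
    then have "cycles_of (set cs \<union> I) (cycle_of_list cs \<circ> p) (cs # css)"
      using css comp.hyps False 1 unfolding cycles_of_def by (auto simp del: comp_apply)
    then show ?thesis using perm by blast
  qed
qed

lemma cycle_type_exists:
  assumes "p \<in> Perms n"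
  obtains css where "cycles_of {..<n} p css" "map length css \<in> partitions n"
proof -
  have "cycle_decomp {..<n} p" using assms unfolding Perms_def by (intro cycle_decomposition) auto
  then obtain css where css: "cycles_of {..<n} p css" using cycle_decomp_cycles_of by blast
  \<comment> \<open>Longest cycles come first, so that the lengths form a partition in the sense of
    \<open>partitions\<close>.\<close>
  define css' where "css' = rev (sort_key length css)"
  have set: "set css' = set css" by (simp add: css'_def)
  have "[] \<notin> set css" using css by (simp add: cycles_of_def)
  then have rem: "removeAll [] css = css" "removeAll [] css' = css'" using set by (simp_all add: removeAll_id)
  have "distinct css' \<longleftrightarrow> distinct css" by (simp add: css'_def)
  then have "distinct (concat css') \<longleftrightarrow> distinct (concat css)"
    unfolding distinct_concat_iff rem set by simp
  moreover have "set (concat css') = set (concat css)" using set by simp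
  ultimately have css': "cycles_of {..<n} p css'"
    using css unfolding cycles_of_def set by simp
  have "sorted_wrt (\<ge>) (map length css')"
    unfolding css'_def rev_map[symmetric] sorted_wrt_rev by simp
  moreover have "0 \<notin> set (map length css')" using css' by (auto simp: cycles_of_def)
  moreover have "sum_list (map length css') = n"
    using css' distinct_card[of "concat css'"] by (simp add: cycles_of_def length_concat)
  ultimately show ?thesis using that css' unfolding partitions_def by blast
qed

text \<open>Write the two lists of cycles below one another: g sends each entry to the one below it,
  and conjugating a cycle by g renames its entries.\<close>

lemma same_cycle_type_conjugate:
  assumes p: "p \<in> Perms n" "cycles_of {..<n} p css" and q: "q \<in> Perms n" "cycles_of {..<n} q css'"
    and len: "map length css = map length css'"
  obtains g where "g \<in> Perms n" "q = g \<circ> p \<circ> inv g"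
proof -
  let ?x = "concat css" and ?y = "concat css'"
  have dx: "distinct ?x" "set ?x = {..<n}" and dy: "distinct ?y" "set ?y = {..<n}"
    using p(2) q(2) unfolding cycles_of_def by auto
  have lx: "length ?x = n" "length ?y = n" using distinct_card[OF dx(1)] dx(2) distinct_card[OF dy(1)] dy(2) by simp_all
  have bx: "bij_betw ((!) ?x) {..<n} {..<n}" and by': "bij_betw ((!) ?y) {..<n} {..<n}"
    using dx dy lx by (auto intro!: bij_betw_nth)
  define g where "g z = (if z < n then ?y ! inv_into {..<n} ((!) ?x) z else z)" for z
  have "bij_betw ((!) ?y \<circ> inv_into {..<n} ((!) ?x)) {..<n} {..<n}"
    using bij_betw_inv_into[OF bx] by' by (rule bij_betw_trans)
  then have "bij_betw g {..<n} {..<n}" by (rule bij_betw_cong[THEN iffD1, rotated]) (simp add: g_def)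
  then have g: "g \<in> Perms n"
    unfolding Perms_def mem_Collect_eq by (rule bij_imp_permutes) (simp add: g_def)
  have "g (?x ! i) = ?y ! i" if "i < n" for i
  proof -
    have "?x ! i < n" using dx(2) lx that nth_mem[of i ?x] by auto
    then show ?thesis using bx that by (simp add: g_def bij_betw_def)
  qed
  then have "map g ?x = ?y" using lx by (auto intro!: nth_equalityI)
  then have "concat (map (map g) css) = concat css'" by (simp add: map_concat)
  moreover have ll: "length css = length css'" using len by (metis length_map)
  moreover have "\<forall>(x, y)\<in>set (zip (map (map g) css) css'). length x = length y"
  proof -
    have "length (css ! i) = length (css' ! i)" if "i < length css" for i
      using len that ll by (metis nth_map)
    then show ?thesis using ll by (auto simp: set_zip)
  qed
  ultimately have css': "css' = map (map g) css"
    by (intro concat_injective[symmetric]) auto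
  have "(g \<circ> p) x = (q \<circ> g) x" for x
  proof (cases "x < n")
    case True
    then obtain cs where cs: "cs \<in> set css" "x \<in> set cs" using dx(2) by auto
    have "distinct cs" using dx(1) cs by (simp add: distinct_concat_iff)
    then have "g \<circ> cycle_of_list cs \<circ> inv g = cycle_of_list (map g cs)"
      by (rule conjugation_of_cycle) (rule bij_Perms[OF g])
    then have "g (cycle_of_list cs x) = cycle_of_list (map g cs) (g x)"
      using comp_inv_Perms(4)[OF g] by (metis comp_apply)
    moreover have "p x = cycle_of_list cs x" using p(2) cs by (simp add: cycles_of_def)
    moreover have "q (g x) = cycle_of_list (map g cs) (g x)" using q(2) cs by (simp add: cycles_of_def css')
    ultimately show ?thesis by simp
  next
    case False
    then have "p x = x" "q x = x" "g x = x" using p(1) q(1) g permutes_not_in[of _ "{..<n}" x]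
      unfolding Perms_def by auto
    then show ?thesis by simp
  qed
  then have "g \<circ> p = q \<circ> g" by blast
  then have "q = g \<circ> p \<circ> inv g" using comp_inv_Perms(7)[OF g, of q] by simp
  with g show ?thesis by (rule that)
qed

text \<open>Up to a scalar the average of c_\<nu> over conjugation, not the sum of a conjugacy
  class. The factor \<open>1\<close> gives it the shape of the linear combinations in
  \<open>ga_mult_sum_left\<close> and \<open>ga_act_sum_left\<close>.\<close>

definition class_sum :: "nat \<Rightarrow> nat list \<Rightarrow> galg" where
  "class_sum n \<nu> = (\<lambda>\<pi>. \<Sum>g\<in>Perms n. 1 *
     ga_mult n (ga_mult n (ga_delta g) (young_symmetrizer n \<nu>)) (ga_delta (inv g)) \<pi>)"

lemma class_sum_in: "class_sum n \<nu> \<in> group_algebra n"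
  unfolding group_algebra_def class_sum_def mem_Collect_eq by (metis (no_types, lifting) ga_mult_notin mult_zero_right sum.neutral)

lemma class_sum_eq:
  assumes "\<pi> \<in> Perms n"
  shows "class_sum n \<nu> \<pi> = (\<Sum>g\<in>Perms n. young_symmetrizer n \<nu> (inv g \<circ> \<pi> \<circ> g))"
  unfolding class_sum_def using assms
  by (intro sum.cong refl)
    (simp add: ga_delta_mult_right inv_in_Perms comp_in_Perms inv_inv_Perms ga_delta_mult_left o_assoc)

lemma class_sum_conj:
  assumes "\<pi> \<in> Perms n" and k: "k \<in> Perms n"
  shows "class_sum n \<nu> (k \<circ> \<pi> \<circ> inv k) = class_sum n \<nu> \<pi>"
proof -
  have "class_sum n \<nu> (k \<circ> \<pi> \<circ> inv k) = (\<Sum>g\<in>Perms n. young_symmetrizer n \<nu> (inv g \<circ> (k \<circ> \<pi> \<circ> inv k) \<circ> g))"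
    using assms by (intro class_sum_eq comp_in_Perms inv_in_Perms)
  also have "\<dots> = (\<Sum>g\<in>Perms n. young_symmetrizer n \<nu> (inv (inv k \<circ> g) \<circ> \<pi> \<circ> (inv k \<circ> g)))"
    using k by (intro sum.cong refl)
      (simp add: o_inv_distrib bij_Perms bij_imp_bij_inv inv_inv_Perms o_assoc)
  also have "\<dots> = (\<Sum>g\<in>Perms n. young_symmetrizer n \<nu> (inv g \<circ> \<pi> \<circ> g))"
    by (rule sum.reindex_bij_betw[OF bij_betw_comp_left_Perms[OF inv_in_Perms[OF k]]])
  also have "\<dots> = class_sum n \<nu> \<pi>" using assms by (simp add: class_sum_eq)
  finally show ?thesis .
qed

text \<open>Conjugation fixes the identity, where c_\<nu> has coefficient 1.\<close>

lemma class_sum_nonzero: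
  assumes "\<nu> \<in> partitions n"
  shows "class_sum n \<nu> \<noteq> (\<lambda>_. 0)"
proof -
  have "class_sum n \<nu> id = of_nat (card (Perms n))"
    by (simp add: class_sum_eq comp_inv_Perms young_symmetrizer_id[OF assms])
  moreover have "card (Perms n) \<noteq> 0" using id_in_Perms[of n] by (metis card_0_eq empty_iff finite_Perms)
  ultimately show ?thesis by (metis of_nat_eq_0_iff)
qed

lemma class_sum_orthogonal:
  assumes "\<nu> \<in> partitions n" "\<mu> \<in> partitions n" "\<nu> \<noteq> \<mu>"
  shows "ga_mult n (ga_mult n (class_sum n \<nu>) y) (class_sum n \<mu>) = (\<lambda>_. 0)"
proof -
  have "ga_mult n (ga_mult n (ga_mult n (ga_mult n (ga_delta g) (young_symmetrizer n \<nu>)) a) y)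
      (ga_mult n (ga_mult n (ga_delta k) (young_symmetrizer n \<mu>)) b) = (\<lambda>_. 0)" for g k a b
  proof -
    have "ga_mult n (ga_mult n (ga_mult n (ga_mult n (ga_delta g) (young_symmetrizer n \<nu>)) a) y)
      (ga_mult n (ga_mult n (ga_delta k) (young_symmetrizer n \<mu>)) b) =
      ga_mult n (ga_mult n (ga_delta g) (ga_mult n (ga_mult n (young_symmetrizer n \<nu>)
        (ga_mult n a (ga_mult n y (ga_delta k)))) (young_symmetrizer n \<mu>))) b"
      by (simp only: ga_mult_assoc)
    then show ?thesis by (simp add: young_symmetrizer_orthogonal[OF assms])
  qed
  then show ?thesis unfolding class_sum_def ga_mult_sum_left ga_mult_sum_right by simp
qed

text \<open>Let z be the class sum of \<mu>. Multiplying the relation by z y on the left removes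
  every term except the one at \<mu>; if its coefficient were nonzero, z y z = 0 for all y, against
  semiprimality.\<close>

lemma class_sums_independent:
  assumes zero: "\<And>\<pi>. (\<Sum>\<nu>\<in>partitions n. \<beta> \<nu> * class_sum n \<nu> \<pi>) = 0" and \<mu>: "\<mu> \<in> partitions n"
  shows "\<beta> \<mu> = 0"
proof (rule ccontr)
  assume nz: "\<beta> \<mu> \<noteq> 0"
  have "class_sum n \<mu> = (\<lambda>_. 0)"
  proof (rule ga_sandwich_self_eq_0[OF class_sum_in])
    fix y
    let ?m = "\<lambda>\<nu>. ga_mult n (ga_mult n (class_sum n \<mu>) y) (class_sum n \<nu>)"
    have "(\<lambda>_. 0) = ga_mult n (ga_mult n (class_sum n \<mu>) y) (\<lambda>\<pi>. \<Sum>\<nu>\<in>partitions n. \<beta> \<nu> * class_sum n \<nu> \<pi>)"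
      by (simp add: zero)
    also have "\<dots> = (\<lambda>\<pi>. \<Sum>\<nu>\<in>partitions n. \<beta> \<nu> * ?m \<nu> \<pi>)" by (rule ga_mult_sum_right)
    also have "\<dots> = (\<lambda>\<pi>. \<beta> \<mu> * ?m \<mu> \<pi>)"
    proof
      fix \<pi>
      have "(\<Sum>\<nu>\<in>partitions n. \<beta> \<nu> * ?m \<nu> \<pi>) = (\<Sum>\<nu>\<in>{\<mu>}. \<beta> \<nu> * ?m \<nu> \<pi>)"
        using \<mu> class_sum_orthogonal[OF \<mu>] finite_partitions
        by (intro sum.mono_neutral_right) auto
      then show "(\<Sum>\<nu>\<in>partitions n. \<beta> \<nu> * ?m \<nu> \<pi>) = \<beta> \<mu> * ?m \<mu> \<pi>" by simp
    qed
    finally show "?m \<mu> = (\<lambda>_. 0)" using nz by (metis mult_eq_0_iff)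
  qed
  with class_sum_nonzero[OF \<mu>] show False by blast
qed

text \<open>The class sums are independent class functions, one for each partition, and there are at
  most as many conjugacy classes as partitions: hence they span all class functions.\<close>

lemma unit_in_span_class_sums:
  obtains \<alpha> where "ga_delta id = (\<lambda>\<pi>. \<Sum>\<nu>\<in>partitions n. \<alpha> \<nu> * class_sum n \<nu> \<pi>)"
proof -
  define has_type where "has_type p \<nu> \<longleftrightarrow> p \<in> Perms n \<and> (\<exists>css. cycles_of {..<n} p css \<and> map length css = \<nu>)" for p \<nu>
  define rep where "rep \<nu> = (SOME p. has_type p \<nu>)" for \<nu>
  \<comment> \<open>\<open>None\<close> stands for the unit of A. With it there is one unknown more
    than there are representatives, so some nontrivial combination vanishes at all of them.\<close>
  define T where "T = insert None (Some ` partitions n)"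
  define F where "F t \<kappa> = (case t of None \<Rightarrow> ga_delta id (rep \<kappa>) | Some \<nu> \<Rightarrow> class_sum n \<nu> (rep \<kappa>))" for t \<kappa>
  have T: "finite T" "card (partitions n) < card T"
    unfolding T_def using finite_partitions by (auto simp: card_image card_insert_if)
  obtain \<beta> where \<beta>: "\<exists>t\<in>T. \<beta> t \<noteq> 0" "\<And>\<kappa>. \<kappa> \<in> partitions n \<Longrightarrow> (\<Sum>t\<in>T. \<beta> t * F t \<kappa>) = 0"
    using exists_linear_dependency[OF finite_partitions T] by metis
  define z where "z \<pi> = \<beta> None * ga_delta id \<pi> + (\<Sum>\<nu>\<in>partitions n. \<beta> (Some \<nu>) * class_sum n \<nu> \<pi>)" for \<pi>
  have "(\<Sum>t\<in>T. \<beta> t * F t \<kappa>) = z (rep \<kappa>)" for \<kappa>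
    unfolding T_def using finite_partitions by (simp add: F_def z_def sum.reindex)
  then have z_rep: "z (rep \<kappa>) = 0" if "\<kappa> \<in> partitions n" for \<kappa> using \<beta>(2) that by simp
  \<comment> \<open>z is constant on conjugacy classes, and every permutation is conjugate to the
    representative of its cycle type.\<close>
  have "z \<pi> = 0" for \<pi>
  proof (cases "\<pi> \<in> Perms n")
    case True
    obtain css where css: "cycles_of {..<n} \<pi> css" "map length css \<in> partitions n"
      using cycle_type_exists[OF True] .
    have "has_type \<pi> (map length css)" using True css by (auto simp: has_type_def)
    then have "has_type (rep (map length css)) (map length css)" unfolding rep_def by (rule someI[of "\<lambda>p. has_type p (map length css)"])
    then obtain css' where r: "rep (map length css) \<in> Perms n"
      "cycles_of {..<n} (rep (map length css)) css'" "map length css' = map length css"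
      by (auto simp: has_type_def)
    obtain g where g: "g \<in> Perms n" "\<pi> = g \<circ> rep (map length css) \<circ> inv g"
      using same_cycle_type_conjugate[OF r(1,2) True css(1) r(3)] .
    have "\<pi> = id \<longleftrightarrow> rep (map length css) = id"
    proof
      assume "\<pi> = id"
      then have "inv g \<circ> (g \<circ> rep (map length css) \<circ> inv g) \<circ> g = inv g \<circ> g" using g(2) by simp
      then show "rep (map length css) = id"
        by (simp add: o_assoc[symmetric] comp_inv_Perms[OF g(1)])
    next
      assume "rep (map length css) = id"
      then show "\<pi> = id" using g by (simp add: comp_inv_Perms)
    qed
    then have "z \<pi> = z (rep (map length css))"
      unfolding z_def ga_delta_def using class_sum_conj[OF r(1) g(1)] g(2) by simp
    then show ?thesis using z_rep css(2) by simp
  next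
    case False
    then have "\<pi> \<noteq> id" by auto
    then show ?thesis using group_algebraD[OF class_sum_in False] by (simp add: z_def ga_delta_def)
  qed
  then have z: "\<beta> None * ga_delta id \<pi> = - (\<Sum>\<nu>\<in>partitions n. \<beta> (Some \<nu>) * class_sum n \<nu> \<pi>)" for \<pi>
    unfolding z_def by (metis eq_neg_iff_add_eq_0)
  \<comment> \<open>Otherwise there would be a nontrivial relation among the class sums
    alone.\<close>
  have nz: "\<beta> None \<noteq> 0"
  proof
    assume "\<beta> None = 0"
    then have "\<beta> (Some \<nu>) = 0" if "\<nu> \<in> partitions n" for \<nu>
      using z that by (intro class_sums_independent[where \<beta> = "\<lambda>\<nu>. \<beta> (Some \<nu>)" and n = n]) auto
    then show False using \<beta>(1) \<open>\<beta> None = 0\<close> by (auto simp: T_def)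
  qed
  have "ga_delta id = (\<lambda>\<pi>. \<Sum>\<nu>\<in>partitions n. (- \<beta> (Some \<nu>) / \<beta> None) * class_sum n \<nu> \<pi>)"
  proof
    fix \<pi>
    have "ga_delta id \<pi> = - (\<Sum>\<nu>\<in>partitions n. \<beta> (Some \<nu>) * class_sum n \<nu> \<pi>) / \<beta> None"
      using z[of \<pi>] nz by (metis nonzero_mult_div_cancel_left)
    also have "\<dots> = (\<Sum>\<nu>\<in>partitions n. (- \<beta> (Some \<nu>) / \<beta> None) * class_sum n \<nu> \<pi>)"
      by (simp add: sum_divide_distrib sum_negf)
    finally show "ga_delta id \<pi> = \<dots>" .
  qed
  then show ?thesis by (rule that)
qed

section \<open>Tensors\<close>

text \<open>A bound N on the indices replaces the individual supports by one range of summation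
  \<open>{..<N}\<close>, common to all tensors in a linear combination.\<close>

definition tensor_below :: "nat \<Rightarrow> nat \<Rightarrow> tensor set" where
  "tensor_below n N = {f. \<forall>xs. f xs \<noteq> 0 \<longrightarrow> length xs = n \<and> set xs \<subseteq> {..<N}}"

lemma tensor_belowD:
  assumes "f \<in> tensor_below n N" "f xs \<noteq> 0"
  shows "length xs = n" "set xs \<subseteq> {..<N}"
  using assms unfolding tensor_below_def by auto

lemma tensor_below_mono: "f \<in> tensor_below n N \<Longrightarrow> N \<le> M \<Longrightarrow> f \<in> tensor_below n M"
  unfolding tensor_below_def by force

lemma tensor_space_below:
  assumes "f \<in> tensor_space n"
  obtains N where "f \<in> tensor_below n N"
proof -
  have "finite (\<Union>xs\<in>{xs. f xs \<noteq> 0}. set xs)" using assms unfolding tensor_space_def by auto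
  then obtain N where "\<forall>x\<in>(\<Union>xs\<in>{xs. f xs \<noteq> 0}. set xs). x < N"
    using finite_nat_set_iff_bounded by blast
  with assms have "f \<in> tensor_below n N" unfolding tensor_below_def tensor_space_def by blast
  then show ?thesis by (rule that)
qed

lemma tensor_below_space: "f \<in> tensor_below n N \<Longrightarrow> f \<in> tensor_space n"
proof -
  assume f: "f \<in> tensor_below n N"
  have "finite {xs. f xs \<noteq> 0}"
    by (rule finite_subset[OF _ finite_lists_length_eq[of "{..<N}" n]])
      (use f in \<open>auto simp: tensor_below_def\<close>)
  with f show ?thesis unfolding tensor_space_def tensor_below_def by blast
qed

lemma tensor_space_common_bound:
  assumes "finite I" "\<And>i. i \<in> I \<Longrightarrow> F i \<in> tensor_space n"
  obtains N where "\<And>i. i \<in> I \<Longrightarrow> F i \<in> tensor_below n N"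
proof -
  have "\<exists>N. \<forall>i\<in>I. F i \<in> tensor_below n N"
    using assms
  proof (induction I rule: finite_induct)
    case (insert a I)
    then obtain N where N: "\<forall>i\<in>I. F i \<in> tensor_below n N" by blast
    obtain M where M: "F a \<in> tensor_below n M" using insert.prems tensor_space_below by blast
    have "\<forall>i\<in>insert a I. F i \<in> tensor_below n (max N M)"
      using N M tensor_below_mono by (metis insert_iff max.cobounded1 max.cobounded2)
    then show ?case by blast
  qed simp
  then show ?thesis using that by blast
qed

lemma tensor_below_sum:
  assumes "\<And>i. i \<in> I \<Longrightarrow> F i \<in> tensor_below n N"
  shows "(\<lambda>xs. \<Sum>i\<in>I. c i * F i xs) \<in> tensor_below n N"
proof -
  have "\<exists>i\<in>I. F i xs \<noteq> 0" if "(\<Sum>i\<in>I. c i * F i xs) \<noteq> 0" for xs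
    using that by (metis (no_types, lifting) mult_zero_right sum.neutral)
  then show ?thesis using assms unfolding tensor_below_def by blast
qed

lemma tensor_space_sum:
  assumes "finite I" "\<And>i. i \<in> I \<Longrightarrow> F i \<in> tensor_space n"
  shows "(\<lambda>xs. \<Sum>i\<in>I. c i * F i xs) \<in> tensor_space n"
proof -
  obtain N where "\<And>i. i \<in> I \<Longrightarrow> F i \<in> tensor_below n N" using tensor_space_common_bound[of I F n] assms by blast
  then show ?thesis by (rule tensor_below_space[OF tensor_below_sum])
qed

subsection \<open>The action of the Lie algebra\<close>

text \<open>The sum in \<open>act_at\<close> runs over a set that depends on the support of f; in
  this form the action is visibly linear in f.\<close>

lemma act_at_eq:
  assumes f: "f \<in> tensor_below n N" and xs: "length xs = n" and j: "j < n"
  shows "act_at T j f xs = (\<Sum>k<N. f (xs[j := k]) * T (ebasis k) (xs ! j))"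
proof -
  let ?Y = "{ys. f ys \<noteq> 0 \<and> length ys = length xs \<and> (\<forall>i. i \<noteq> j \<longrightarrow> ys ! i = xs ! i)}"
  let ?K = "{k. k < N \<and> f (xs[j := k]) \<noteq> 0}"
  have inj: "inj_on (\<lambda>k. xs[j := k]) ?K"
    using xs j by (intro inj_onI) (metis nth_list_update_eq)
  have "?Y = (\<lambda>k. xs[j := k]) ` ?K"
  proof (intro set_eqI iffI)
    fix ys assume ys: "ys \<in> ?Y"
    have "ys = xs[j := ys ! j]"
    proof (rule nth_equalityI)
      fix i
      show "ys ! i = xs[j := ys ! j] ! i" using ys xs j by (cases "i = j") simp_all
    qed (use ys in simp)
    moreover have "ys ! j < N" using tensor_belowD(2)[OF f, of ys] ys xs j by (auto simp: set_conv_nth)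
    ultimately show "ys \<in> (\<lambda>k. xs[j := k]) ` ?K" using ys by (intro image_eqI[of _ _ "ys ! j"]) auto
  qed auto
  then have "act_at T j f xs = (\<Sum>k\<in>?K. f (xs[j := k]) * T (ebasis (xs[j := k] ! j)) (xs ! j))"
    unfolding act_at_def using sum.reindex[OF inj] by simp
  also have "\<dots> = (\<Sum>k\<in>?K. f (xs[j := k]) * T (ebasis k) (xs ! j))"
    using xs j by simp
  also have "\<dots> = (\<Sum>k<N. f (xs[j := k]) * T (ebasis k) (xs ! j))"
    by (rule sum.mono_neutral_left) auto
  finally show ?thesis .
qed

lemma gl_act_eq:
  assumes f: "f \<in> tensor_below n N"
  shows "gl_act T n f = (\<lambda>xs. if length xs = n
           then \<Sum>j<n. \<Sum>k<N. f (xs[j := k]) * T (ebasis k) (xs ! j) else 0)"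
proof
  fix xs
  show "gl_act T n f xs = (if length xs = n
           then \<Sum>j<n. \<Sum>k<N. f (xs[j := k]) * T (ebasis k) (xs ! j) else 0)"
  proof (cases "length xs = n")
    case True
    then show ?thesis unfolding gl_act_def using act_at_eq[OF f] by simp
  next
    case False
    then have "{ys. f ys \<noteq> 0 \<and> length ys = length xs \<and> (\<forall>i. i \<noteq> j \<longrightarrow> ys ! i = xs ! i)} = {}" for j
      using tensor_belowD(1)[OF f] by auto
    then have "act_at T j f xs = 0" for j unfolding act_at_def by (simp only: sum.empty)
    then show ?thesis using False unfolding gl_act_def by simp
  qed
qed

text \<open>A tensor sees an operator only through its values on the basis vectors that occur. This
  lets matrix units stand in for elements of \<open>verma_ops\<close>.\<close>

lemma gl_act_cong:
  assumes "f \<in> tensor_below n N" "\<And>k. k < N \<Longrightarrow> T (ebasis k) = T' (ebasis k)"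
  shows "gl_act T n f = gl_act T' n f"
  unfolding gl_act_eq[OF assms(1)] using assms(2) by (intro ext if_cong sum.cong refl) simp_all

lemma gl_act_sum:
  assumes "finite I" "\<And>i. i \<in> I \<Longrightarrow> F i \<in> tensor_space n"
  shows "gl_act T n (\<lambda>xs. \<Sum>i\<in>I. c i * F i xs) = (\<lambda>xs. \<Sum>i\<in>I. c i * gl_act T n (F i) xs)"
proof -
  obtain N where N: "\<And>i. i \<in> I \<Longrightarrow> F i \<in> tensor_below n N" using tensor_space_common_bound[of I F n] assms by blast
  have below: "(\<lambda>xs. \<Sum>i\<in>I. c i * F i xs) \<in> tensor_below n N" using N by (rule tensor_below_sum)
  have "gl_act T n (\<lambda>xs. \<Sum>i\<in>I. c i * F i xs) xs = (\<Sum>i\<in>I. c i * gl_act T n (F i) xs)" for xs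
  proof (cases "length xs = n")
    case True
    have "gl_act T n (\<lambda>xs. \<Sum>i\<in>I. c i * F i xs) xs =
        (\<Sum>j<n. \<Sum>k<N. \<Sum>i\<in>I. c i * (F i (xs[j := k]) * T (ebasis k) (xs ! j)))"
      using True gl_act_eq[OF below] by (simp add: sum_distrib_right mult.assoc)
    also have "\<dots> = (\<Sum>j<n. \<Sum>i\<in>I. \<Sum>k<N. c i * (F i (xs[j := k]) * T (ebasis k) (xs ! j)))"
      by (intro sum.cong refl sum.swap)
    also have "\<dots> = (\<Sum>i\<in>I. \<Sum>j<n. \<Sum>k<N. c i * (F i (xs[j := k]) * T (ebasis k) (xs ! j)))"
      by (rule sum.swap)
    also have "\<dots> = (\<Sum>i\<in>I. c i * gl_act T n (F i) xs)"
      using True by (intro sum.cong refl) (simp add: gl_act_eq[OF N] sum_distrib_left)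
    finally show ?thesis .
  next
    case False
    then show ?thesis using gl_act_eq[OF below] gl_act_eq[OF N] by simp
  qed
  then show ?thesis by blast
qed

text \<open>\<open>vec\<close> contains all functions; the operators have to preserve the finitely
  supported ones, which are the elements of V.\<close>

lemma verma_ops_finite_support:
  assumes "T \<in> verma_ops lam" "finite {i. f i \<noteq> 0}"
  shows "finite {i. T f i \<noteq> 0}"
  using assms
proof (induction arbitrary: f rule: verma_ops.induct)
  case ops_X
  have "{i. X_op lam f i \<noteq> 0} \<subseteq> Suc -` {i. f i \<noteq> 0}" by (auto simp: X_op_def)
  then show ?case using ops_X finite_vimageI[of "{i. f i \<noteq> 0}" Suc] by (auto intro: finite_subset)
next
  case ops_H
  then show ?case by (rule rev_finite_subset) (auto simp: H_op_def)
next
  case ops_Y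
  have "{i. Y_op f i \<noteq> 0} \<subseteq> Suc ` {i. f i \<noteq> 0}"
    by (auto simp: Y_op_def image_iff split: if_splits intro!: exI[of _ "_ - 1"])
  then show ?case using ops_Y by (auto intro: finite_subset)
next
  case (ops_add S T)
  have "{i. S f i + T f i \<noteq> 0} \<subseteq> {i. S f i \<noteq> 0} \<union> {i. T f i \<noteq> 0}" by auto
  then show ?case using ops_add by (auto intro: finite_subset)
next
  case (ops_smult T c)
  then have "finite {i. T f i \<noteq> 0}" by blast
  then show ?case by (rule rev_finite_subset) auto
qed auto

lemma gl_act_in_tensor_space:
  assumes T: "T \<in> verma_ops lam" and "f \<in> tensor_space n"
  shows "gl_act T n f \<in> tensor_space n"
proof -
  obtain N where f: "f \<in> tensor_below n N" using assms(2) tensor_space_below by blast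
  have "finite {i. T (ebasis k) i \<noteq> 0}" for k
    using T by (rule verma_ops_finite_support) (simp add: ebasis_def)
  then have "finite (\<Union>k<N. {i. T (ebasis k) i \<noteq> 0})" by blast
  then obtain M where M: "\<And>k i. k < N \<Longrightarrow> T (ebasis k) i \<noteq> 0 \<Longrightarrow> i < M"
    unfolding finite_nat_set_iff_bounded by auto
  have "gl_act T n f \<in> tensor_below n (max N M)"
    unfolding tensor_below_def mem_Collect_eq
  proof (intro allI impI)
    fix xs assume nz: "gl_act T n f xs \<noteq> 0"
    then have len: "length xs = n" unfolding gl_act_eq[OF f] by presburger
    with nz have "(\<Sum>j<n. \<Sum>k<N. f (xs[j := k]) * T (ebasis k) (xs ! j)) \<noteq> 0"
      by (simp add: gl_act_eq[OF f])
    then obtain j k where jk: "j < n" "k < N" "f (xs[j := k]) * T (ebasis k) (xs ! j) \<noteq> 0"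
      by (metis (no_types, lifting) lessThan_iff sum.neutral)
    then have "xs ! j < M" and sub: "set (xs[j := k]) \<subseteq> {..<N}" using M tensor_belowD[OF f] by auto
    have "xs ! i < max N M" if "i < n" for i
    proof (cases "i = j")
      case False
      then have "xs ! i \<in> set (xs[j := k])" using that len by (metis length_list_update nth_list_update_neq nth_mem)
      then show ?thesis using sub by auto
    qed (use \<open>xs ! j < M\<close> in auto)
    then show "length xs = n \<and> set xs \<subseteq> {..<max N M}" using len by (auto simp: set_conv_nth)
  qed
  then show ?thesis by (rule tensor_below_space)
qed

subsection \<open>The action of the symmetric group\<close>

lemma sym_act_eq: "sym_act n \<sigma> f = (\<lambda>xs. if length xs = n then f (permute_list \<sigma> xs) else 0)"
  unfolding sym_act_def permute_list_def by auto

text \<open>Permuting lists reverses the order of composition; precomposing a coefficient function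
  with it reverses the order again, so \<open>sym_act\<close> is a left action.\<close>

lemma permute_list_comp_Perms:
  "\<tau> \<in> Perms n \<Longrightarrow> length xs = n \<Longrightarrow> permute_list \<tau> (permute_list \<sigma> xs) = permute_list (\<sigma> \<circ> \<tau>) xs"
  unfolding Perms_def by (auto simp: permute_list_compose)

lemma set_permute_list_Perms: "\<sigma> \<in> Perms n \<Longrightarrow> length xs = n \<Longrightarrow> set (permute_list \<sigma> xs) = set xs"
  unfolding Perms_def by auto

lemma permute_list_inv_Perms:
  assumes "\<sigma> \<in> Perms n" "length xs = n"
  shows "permute_list \<sigma> (permute_list (inv \<sigma>) xs) = xs" "permute_list (inv \<sigma>) (permute_list \<sigma> xs) = xs"
  using assms
  by (simp_all add: permute_list_comp_Perms[OF inv_in_Perms[OF assms(1)]] permute_list_comp_Perms[OF assms(1)]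
      comp_inv_Perms)

lemma permute_list_Perms_inj:
  assumes "\<sigma> \<in> Perms n" "\<tau> \<in> Perms n" "length xs = n" "distinct xs" "permute_list \<sigma> xs = permute_list \<tau> xs"
  shows "\<sigma> = \<tau>"
proof
  fix i
  show "\<sigma> i = \<tau> i"
  proof (cases "i < n")
    case True
    have "permute_list \<sigma> xs ! i = xs ! \<sigma> i" "permute_list \<tau> xs ! i = xs ! \<tau> i"
      using True assms(3) by (simp_all add: permute_list_def)
    then have "xs ! \<sigma> i = xs ! \<tau> i" using assms(5) by simp
    then show ?thesis using assms True by (simp add: nth_eq_iff_index_eq Perms_less)
  next
    case False
    then show ?thesis using assms(1,2) permutes_not_in[of _ "{..<n}" i] unfolding Perms_def
      by (metis lessThan_iff mem_Collect_eq)
  qed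
qed

lemma sym_act_below:
  assumes "f \<in> tensor_below n N" "\<sigma> \<in> Perms n"
  shows "sym_act n \<sigma> f \<in> tensor_below n N"
  unfolding tensor_below_def sym_act_eq mem_Collect_eq
  using tensor_belowD[OF assms(1)] set_permute_list_Perms[OF assms(2)] by metis

lemma sym_act_in_tensor_space: "f \<in> tensor_space n \<Longrightarrow> \<sigma> \<in> Perms n \<Longrightarrow> sym_act n \<sigma> f \<in> tensor_space n"
  by (meson tensor_space_below sym_act_below tensor_below_space)

text \<open>The permutation only reorders the sum over places in \<open>gl_act\<close>: place j of
  the permuted list is place \<open>\<sigma> j\<close> of the original one.\<close>

lemma gl_act_sym_act:
  assumes "f \<in> tensor_space n" and \<sigma>: "\<sigma> \<in> Perms n"
  shows "gl_act T n (sym_act n \<sigma> f) = sym_act n \<sigma> (gl_act T n f)"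
proof
  fix xs
  obtain N where f: "f \<in> tensor_below n N" using assms(1) tensor_space_below by blast
  show "gl_act T n (sym_act n \<sigma> f) xs = sym_act n \<sigma> (gl_act T n f) xs"
  proof (cases "length xs = n")
    case True
    have upd: "permute_list \<sigma> (xs[\<sigma> j := k]) = (permute_list \<sigma> xs)[j := k]" if "j < n" for j k
    proof (rule nth_equalityI)
      fix i assume "i < length (permute_list \<sigma> (xs[\<sigma> j := k]))"
      then have i: "i < n" using True by simp
      have "\<sigma> i = \<sigma> j \<longleftrightarrow> i = j" using comp_inv_Perms(4)[OF \<sigma>] by metis
      then show "permute_list \<sigma> (xs[\<sigma> j := k]) ! i = (permute_list \<sigma> xs)[j := k] ! i"
        using i that True \<sigma> by (auto simp: permute_list_def nth_list_update Perms_less)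
    qed simp
    have "gl_act T n (sym_act n \<sigma> f) xs =
        (\<Sum>j<n. \<Sum>k<N. f (permute_list \<sigma> (xs[j := k])) * T (ebasis k) (xs ! j))"
      using True by (simp add: gl_act_eq[OF sym_act_below[OF f \<sigma>]]) (simp add: sym_act_eq)
    also have "\<dots> = (\<Sum>j<n. \<Sum>k<N. f (permute_list \<sigma> (xs[\<sigma> j := k])) * T (ebasis k) (xs ! \<sigma> j))"
      using sum.reindex_bij_betw[OF bij_betw_Perms[OF \<sigma>]] by (rule sym)
    also have "\<dots> = (\<Sum>j<n. \<Sum>k<N. f ((permute_list \<sigma> xs)[j := k]) * T (ebasis k) (permute_list \<sigma> xs ! j))"
      using True by (intro sum.cong refl) (simp add: upd, simp add: permute_list_def)
    also have "\<dots> = sym_act n \<sigma> (gl_act T n f) xs"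
      using True by (simp add: sym_act_eq gl_act_eq[OF f])
    finally show ?thesis .
  next
    case False
    then show ?thesis by (simp add: gl_act_eq[OF sym_act_below[OF f \<sigma>]]) (simp add: sym_act_eq)
  qed
qed

section \<open>The group algebra acting on tensors\<close>

definition ga_act :: "nat \<Rightarrow> galg \<Rightarrow> tensor \<Rightarrow> tensor" where
  "ga_act n a f = (\<lambda>xs. \<Sum>\<sigma>\<in>Perms n. a \<sigma> * sym_act n \<sigma> f xs)"

lemma ga_act_in_tensor_space: "f \<in> tensor_space n \<Longrightarrow> ga_act n a f \<in> tensor_space n"
  unfolding ga_act_def by (rule tensor_space_sum) (auto simp: sym_act_in_tensor_space)

lemma gl_act_ga_act:
  assumes "f \<in> tensor_space n"
  shows "gl_act T n (ga_act n a f) = ga_act n a (gl_act T n f)"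
proof -
  have "gl_act T n (ga_act n a f) = (\<lambda>xs. \<Sum>\<sigma>\<in>Perms n. a \<sigma> * gl_act T n (sym_act n \<sigma> f) xs)"
    unfolding ga_act_def by (rule gl_act_sum) (auto simp: assms sym_act_in_tensor_space)
  then show ?thesis unfolding ga_act_def using gl_act_sym_act[OF assms] by simp
qed

lemma ga_act_mult: "ga_act n (ga_mult n a b) f = ga_act n a (ga_act n b f)"
proof
  fix xs
  show "ga_act n (ga_mult n a b) f xs = ga_act n a (ga_act n b f) xs"
  proof (cases "length xs = n")
    case True
    have "ga_act n (ga_mult n a b) f xs = (\<Sum>\<sigma>\<in>Perms n. \<Sum>\<tau>\<in>Perms n. a \<sigma> * b \<tau> * sym_act n (\<sigma> \<circ> \<tau>) f xs)"
      unfolding ga_act_def by (rule sum_ga_mult)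
    also have "\<dots> = ga_act n a (ga_act n b f) xs"
      using True unfolding ga_act_def sym_act_eq sum_distrib_left
      by (intro sum.cong refl) (simp add: sum_distrib_left mult.assoc permute_list_comp_Perms)
    finally show ?thesis .
  qed (simp add: ga_act_def sym_act_eq)
qed

lemma ga_act_delta: "\<sigma> \<in> Perms n \<Longrightarrow> ga_act n (ga_delta \<sigma>) f = sym_act n \<sigma> f"
  unfolding ga_act_def ga_delta_def by (simp add: if_distrib[of "\<lambda>x. x * _"] cong: if_cong)

lemma ga_act_one: "f \<in> tensor_space n \<Longrightarrow> ga_act n (ga_delta id) f = f"
  by (auto simp: ga_act_delta sym_act_eq tensor_space_def fun_eq_iff)

lemma ga_act_sum_left: "ga_act n (\<lambda>\<pi>. \<Sum>i\<in>I. k i * A i \<pi>) f = (\<lambda>xs. \<Sum>i\<in>I. k i * ga_act n (A i) f xs)"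
  unfolding ga_act_def
  by (simp add: sum_distrib_left sum_distrib_right mult.assoc) (rule ext, rule sum.swap)

lemma ga_act_scale_left: "ga_act n (\<lambda>\<pi>. k * a \<pi>) f = (\<lambda>xs. k * ga_act n a f xs)"
  unfolding ga_act_def by (simp add: sum_distrib_left mult.assoc)

lemma ga_act_sum_right: "ga_act n a (\<lambda>xs. \<Sum>i\<in>I. k i * F i xs) = (\<lambda>xs. \<Sum>i\<in>I. k i * ga_act n a (F i) xs)"
proof
  fix xs
  show "ga_act n a (\<lambda>xs. \<Sum>i\<in>I. k i * F i xs) xs = (\<Sum>i\<in>I. k i * ga_act n a (F i) xs)"
    unfolding ga_act_def sym_act_eq
    by (cases "length xs = n")
      (simp_all add: sum_distrib_left, subst sum.swap, intro sum.cong refl, simp)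
qed

lemma ga_act_scale_right: "ga_act n a (\<lambda>xs. k * f xs) = (\<lambda>xs. k * ga_act n a f xs)"
  using ga_act_sum_right[of n a "\<lambda>_. k" "\<lambda>_. f" "{()}"] by simp

lemma ga_act_lincomb_right:
  "ga_act n a (\<lambda>xs. c * f xs + d * g xs) = (\<lambda>xs. c * ga_act n a f xs + d * ga_act n a g xs)"
  using ga_act_sum_right[of n a "\<lambda>b. if b then c else d" "\<lambda>b. if b then f else g" UNIV]
  by (simp add: UNIV_bool add.commute)

lemma ga_act_lincomb_left:
  "ga_act n (\<lambda>\<pi>. c * a \<pi> + d * b \<pi>) f = (\<lambda>xs. c * ga_act n a f xs + d * ga_act n b f xs)"
  using ga_act_sum_left[of n "\<lambda>t. if t then c else d" "\<lambda>t. if t then a else b" UNIV]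
  by (simp add: UNIV_bool add.commute)

subsection \<open>Basis tensors\<close>

definition tbasis :: "nat list \<Rightarrow> tensor" where
  "tbasis ys = (\<lambda>xs. if xs = ys then 1 else 0)"

lemma tbasis_in: "length ys = n \<Longrightarrow> tbasis ys \<in> tensor_space n"
  by (auto simp: tensor_space_def tbasis_def)

lemma tensor_expand:
  assumes "f \<in> tensor_space n"
  shows "f = (\<lambda>xs. \<Sum>ys\<in>{ys. f ys \<noteq> 0}. f ys * tbasis ys xs)"
  using assms by (auto simp: tensor_space_def tbasis_def fun_eq_iff if_distrib[of "\<lambda>x. _ * x"] cong: if_cong)

lemma sym_act_tbasis:
  assumes "\<sigma> \<in> Perms n" "length ys = n"
  shows "sym_act n \<sigma> (tbasis ys) = tbasis (permute_list (inv \<sigma>) ys)"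
proof
  fix xs
  have "permute_list \<sigma> xs = ys \<longleftrightarrow> xs = permute_list (inv \<sigma>) ys" if "length xs = n"
    using permute_list_inv_Perms[OF assms] permute_list_inv_Perms[OF assms(1) that] by metis
  then show "sym_act n \<sigma> (tbasis ys) xs = tbasis (permute_list (inv \<sigma>) ys) xs"
    using assms(2) by (auto simp: sym_act_eq tbasis_def)
qed

lemma ga_act_tbasis:
  "length ys = n \<Longrightarrow> ga_act n a (tbasis ys) xs = (\<Sum>\<sigma>\<in>Perms n. a \<sigma> * tbasis (permute_list (inv \<sigma>) ys) xs)"
  unfolding ga_act_def by (intro sum.cong refl) (simp add: sym_act_tbasis)

text \<open>The rearrangements of a list with distinct entries are all different, so such a basis
  tensor generates a free module over A and identities in A can be tested on it.\<close>

lemma ga_act_tbasis_coeff: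
  assumes ys: "length ys = n" "distinct ys" and \<sigma>: "\<sigma> \<in> Perms n"
  shows "ga_act n a (tbasis ys) (permute_list (inv \<sigma>) ys) = a \<sigma>"
proof -
  have "permute_list (inv \<sigma>) ys = permute_list (inv \<tau>) ys \<longleftrightarrow> \<tau> = \<sigma>" if "\<tau> \<in> Perms n" for \<tau>
    using permute_list_Perms_inj[OF inv_in_Perms[OF \<sigma>] inv_in_Perms[OF that] ys]
      inv_inv_Perms[OF \<sigma>] inv_inv_Perms[OF that] by metis
  then have "ga_act n a (tbasis ys) (permute_list (inv \<sigma>) ys) = (\<Sum>\<tau>\<in>Perms n. if \<tau> = \<sigma> then a \<tau> else 0)"
    unfolding ga_act_tbasis[OF ys(1)] by (intro sum.cong refl) (simp add: tbasis_def)
  then show ?thesis using \<sigma> by simp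
qed

section \<open>Matrix units\<close>

text \<open>The target index comes first. Elements of \<open>verma_ops\<close> can be made to agree
  with it on any initial range of basis vectors.\<close>

definition munit :: "nat \<Rightarrow> nat \<Rightarrow> vec \<Rightarrow> vec" where
  "munit y x f = (\<lambda>i. if i = y then f x else 0)"

text \<open>The operator is the product over m in M of H minus its eigenvalue on e_m. It kills no
  further basis vector because the eigenvalues lam - 1 - 2 k are distinct.\<close>

lemma verma_ops_diagonal:
  assumes "finite M"
  shows "\<exists>T\<in>verma_ops lam. \<exists>\<phi>. (\<forall>k. T (ebasis k) = (\<lambda>i. \<phi> k * ebasis k i)) \<and> (\<forall>k. \<phi> k = 0 \<longleftrightarrow> k \<in> M)"
  using assms
proof (induction M rule: finite_induct)
  case empty
  show ?case by (intro bexI[OF _ ops_id] exI[of _ "\<lambda>_. 1"]) auto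
next
  case (insert m M)
  then obtain T \<phi> where T: "T \<in> verma_ops lam" "\<And>k. T (ebasis k) = (\<lambda>i. \<phi> k * ebasis k i)"
    "\<And>k. \<phi> k = 0 \<longleftrightarrow> k \<in> M" by blast
  define S where "S = (\<lambda>f i. H_op lam f i + - (lam - 1 - 2 * of_nat m) * id f i)"
  have S: "S \<in> verma_ops lam" unfolding S_def by (intro ops_add ops_smult ops_H ops_id)
  have "(S \<circ> T) (ebasis k) = (\<lambda>i. (2 * (of_nat m - of_nat k) * \<phi> k) * ebasis k i)" for k
    by (rule ext) (simp add: S_def T(2) H_op_def, simp add: ebasis_def algebra_simps)
  moreover have "2 * (of_nat m - of_nat k) * \<phi> k = 0 \<longleftrightarrow> k \<in> insert m M" for k
    by (auto simp: T(3))
  ultimately show ?case using ops_comp[OF S T(1)]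
    by (intro bexI[of _ "S \<circ> T"] exI[of _ "\<lambda>k. 2 * (of_nat m - of_nat k) * \<phi> k"]) blast+
qed

text \<open>The operator is X^x, and d is the product of j (lam - j) for j from 1 to x. The scalar c
  is carried along so that the operators compose on multiples of basis vectors.\<close>

lemma verma_ops_lower:
  assumes "lam \<notin> \<int> - {0}"
  shows "\<exists>T\<in>verma_ops lam. \<exists>d. d \<noteq> 0 \<and> (\<forall>c. T (\<lambda>i. c * ebasis x i) = (\<lambda>i. c * d * ebasis 0 i))"
proof (induction x)
  case 0
  show ?case by (intro bexI[OF _ ops_id] exI[of _ 1]) auto
next
  case (Suc x)
  then obtain T d where T: "T \<in> verma_ops lam" "d \<noteq> 0"
    "\<And>c. T (\<lambda>i. c * ebasis x i) = (\<lambda>i. c * d * ebasis 0 i)" by blast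
  define e where "e = of_nat (Suc x) * (lam - of_nat (Suc x))"
  have "lam \<noteq> of_nat (Suc x)" using assms
    by (metis DiffI Ints_of_nat of_nat_eq_0_iff old.nat.distinct(2) singletonD)
  then have "e \<noteq> 0" by (simp add: e_def del: of_nat_Suc)
  have "X_op lam (\<lambda>i. c * ebasis (Suc x) i) = (\<lambda>i. (c * e) * ebasis x i)" for c
    by (rule ext) (simp add: X_op_def ebasis_def e_def)
  then have "(T \<circ> X_op lam) (\<lambda>i. c * ebasis (Suc x) i) = (\<lambda>i. c * (e * d) * ebasis 0 i)" for c
    using T(3)[of "c * e"] by (simp add: mult.assoc)
  moreover have "e * d \<noteq> 0" using \<open>e \<noteq> 0\<close> T(2) by simp
  ultimately show ?case using ops_comp[OF T(1) ops_X] by blast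
qed

lemma verma_ops_raise:
  "\<exists>T\<in>verma_ops lam. \<forall>c. T (\<lambda>i. c * ebasis 0 i) = (\<lambda>i. c * ebasis y i)"
proof (induction y)
  case 0
  show ?case by (intro bexI[OF _ ops_id]) auto
next
  case (Suc y)
  then obtain T where T: "T \<in> verma_ops lam" "\<And>c. T (\<lambda>i. c * ebasis 0 i) = (\<lambda>i. c * ebasis y i)" by blast
  have "(Y_op \<circ> T) (\<lambda>i. c * ebasis 0 i) = (\<lambda>i. c * ebasis (Suc y) i)" for c
    by (rule ext) (simp add: T(2) Y_op_def, auto simp: ebasis_def)
  then show ?case using ops_comp[OF ops_Y T(1)] by blast
qed

lemma verma_ops_matrix_unit:
  assumes "lam \<notin> \<int> - {0}"
  shows "\<exists>T\<in>verma_ops lam. \<forall>k<N. T (ebasis k) = munit y x (ebasis k)"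
proof -
  obtain P \<phi> where P: "P \<in> verma_ops lam" "\<And>k. P (ebasis k) = (\<lambda>i. \<phi> k * ebasis k i)"
    "\<And>k. \<phi> k = 0 \<longleftrightarrow> k \<in> {..<N} - {x}"
    using verma_ops_diagonal[of "{..<N} - {x}" lam] by blast
  obtain L d where L: "L \<in> verma_ops lam" "d \<noteq> 0"
    "\<And>c. L (\<lambda>i. c * ebasis x i) = (\<lambda>i. c * d * ebasis 0 i)"
    using verma_ops_lower[OF assms] by blast
  obtain R where R: "R \<in> verma_ops lam" "\<And>c. R (\<lambda>i. c * ebasis 0 i) = (\<lambda>i. c * ebasis y i)"
    using verma_ops_raise by blast
  \<comment> \<open>P isolates e_x among the first N basis vectors, L takes it to e_0 and R from
    there to e_y; the scalar undoes the factors \<open>\<phi> x\<close> and d.\<close>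
  define T where "T = (\<lambda>f i. (1 / (\<phi> x * d)) * (R \<circ> (L \<circ> P)) f i)"
  have \<phi>x: "\<phi> x \<noteq> 0" using P(3) by simp
  have "T (ebasis k) = munit y x (ebasis k)" if "k < N" for k
  proof -
    \<comment> \<open>For \<open>x \<ge> N\<close> this is always 0, as it should be: P then kills
      all the vectors in question.\<close>
    define c where "c = (if k = x then \<phi> x else 0)"
    have "P (ebasis k) = (\<lambda>i. c * ebasis x i)"
      using P(2)[of k] P(3)[of k] that by (auto simp: c_def)
    then have "T (ebasis k) = (\<lambda>i. 1 / (\<phi> x * d) * (c * d * ebasis y i))"
      by (simp add: T_def L(3) R(2))
    then show ?thesis using \<phi>x L(2) by (auto simp: c_def munit_def ebasis_def)
  qed
  moreover have "T \<in> verma_ops lam" unfolding T_def by (intro ops_smult ops_comp P L R)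
  ultimately show ?thesis by blast
qed

text \<open>The element of \<open>verma_ops\<close> that imitates the matrix unit depends on f, but
  membership in U is a statement about one f at a time.\<close>

lemma gl_invariant_munit:
  assumes lam: "lam \<notin> \<int> - {0}" and "gl_invariant lam n U" "U \<subseteq> tensor_space n" "f \<in> U"
  shows "gl_act (munit y x) n f \<in> U"
proof -
  obtain N where N: "f \<in> tensor_below n N" using assms(3,4) tensor_space_below by blast
  obtain T where T: "T \<in> verma_ops lam" "\<And>k. k < N \<Longrightarrow> T (ebasis k) = munit y x (ebasis k)"
    using verma_ops_matrix_unit[OF lam] by metis
  have "gl_act T n f \<in> U" using assms(2,4) T(1) unfolding gl_invariant_def by blast
  then show ?thesis using gl_act_cong[OF N, of T "munit y x"] T(2) by simp
qed

lemma gl_act_munit: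
  assumes "f \<in> tensor_space n"
  shows "gl_act (munit y x) n f = (\<lambda>zs. if length zs = n
           then \<Sum>j<n. if zs ! j = y then f (zs[j := x]) else 0 else 0)"
proof -
  obtain N where "f \<in> tensor_below n N" using assms tensor_space_below by blast
  \<comment> \<open>The bound is raised above x so that the index \<open>k = x\<close> belongs to
    the range of summation.\<close>
  then have N: "f \<in> tensor_below n (max N (Suc x))" by (rule tensor_below_mono) simp
  have inner: "(\<Sum>k<max N (Suc x). f (zs[j := k]) * munit y x (ebasis k) (zs ! j)) =
      (if zs ! j = y then f (zs[j := x]) else 0)" for zs j
  proof -
    have "(\<Sum>k<max N (Suc x). f (zs[j := k]) * munit y x (ebasis k) (zs ! j)) =
        (\<Sum>k<max N (Suc x). if k = x then (if zs ! j = y then f (zs[j := x]) else 0) else 0)"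
      by (intro sum.cong refl) (auto simp: munit_def ebasis_def)
    also have "\<dots> = (if zs ! j = y then f (zs[j := x]) else 0)" by (subst sum.delta) auto
    finally show ?thesis .
  qed
  show ?thesis unfolding gl_act_eq[OF N] inner ..
qed

section \<open>Irreducibility\<close>

lemma is_subspace_sum:
  assumes U: "is_subspace U" and "\<And>i. i \<in> I \<Longrightarrow> F i \<in> U"
  shows "(\<lambda>x. \<Sum>i\<in>I. c i * F i x) \<in> U"
proof (cases "finite I")
  case True
  then show ?thesis using assms(2)
  proof (induction I rule: finite_induct)
    case empty
    then show ?case using U by (simp add: is_subspace_def)
  next
    case (insert a I)
    have "(\<lambda>x. c a * F a x) \<in> U" using U insert.prems unfolding is_subspace_def by simp
    moreover have "(\<lambda>x. \<Sum>i\<in>I. c i * F i x) \<in> U" using insert by simp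
    ultimately have "(\<lambda>x. c a * F a x + (\<Sum>i\<in>I. c i * F i x)) \<in> U"
      using U unfolding is_subspace_def by simp
    then show ?case using insert.hyps by simp
  qed
qed (use U in \<open>simp add: is_subspace_def\<close>)

section \<open>Replacing the entries of a basis tensor one at a time\<close>

lemma take_append_drop_nth:
  assumes "length as = n" "length xs = n" "k \<le> n" "j < n"
  shows "(take k as @ drop k xs) ! j = (if j < k then as ! j else xs ! j)"
  using assms by (simp add: nth_append min_def)

lemma take_append_drop_update:
  assumes "length as = n" "length xs = n" "k < n"
  shows "(take k as @ drop k xs)[k := as ! k] = take (Suc k) as @ drop (Suc k) xs"
    and "(take (Suc k) as @ drop (Suc k) xs)[k := xs ! k] = take k as @ drop k xs"
proof -
  note nth = take_append_drop_nth[OF assms(1,2)]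
  have len: "length (take k as @ drop k xs) = n" "length (take (Suc k) as @ drop (Suc k) xs) = n"
    using assms by simp_all
  show "(take k as @ drop k xs)[k := as ! k] = take (Suc k) as @ drop (Suc k) xs"
  proof (rule nth_equalityI)
    fix j assume "j < length ((take k as @ drop k xs)[k := as ! k])"
    then have j: "j < n" using len by (simp only: length_list_update)
    show "(take k as @ drop k xs)[k := as ! k] ! j = (take (Suc k) as @ drop (Suc k) xs) ! j"
      using j assms(3) len by (cases "j = k") (simp_all add: nth del: length_append)
  qed (simp only: length_list_update len)
  show "(take (Suc k) as @ drop (Suc k) xs)[k := xs ! k] = take k as @ drop k xs"
  proof (rule nth_equalityI)
    fix j assume "j < length ((take (Suc k) as @ drop (Suc k) xs)[k := xs ! k])"
    then have j: "j < n" using len by (simp only: length_list_update)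
    show "(take (Suc k) as @ drop (Suc k) xs)[k := xs ! k] ! j = (take k as @ drop k xs) ! j"
      using j assms(3) len by (cases "j = k") (simp_all add: nth del: length_append)
  qed (simp only: length_list_update len)
qed

text \<open>Written additively to avoid subtraction of natural numbers.\<close>

lemma count_mset_update:
  assumes "j < length zs"
  shows "count (mset (zs[j := b])) a + (if zs ! j = a then 1 else 0) = count (mset zs) a + (if b = a then 1 else 0)"
proof -
  have "mset zs = add_mset (zs ! j) (mset zs - {#zs ! j#})" using assms by simp
  then have "count (mset zs) a = count (add_mset (zs ! j) (mset zs - {#zs ! j#})) a" by (rule arg_cong)
  then show ?thesis using assms by (auto simp: mset_update)
qed

text \<open>Moving the entries of a basis tensor one by one to fresh distinct indices \<open>as\<close> cannot
  produce cancellation, and it ends in the multiplicity-free weight space, which is a copy of the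
  group algebra.\<close>

lemma move_to_fresh:
  assumes lam: "lam \<notin> \<int> - {0}" and U: "gl_invariant lam n U" "U \<subseteq> tensor_space n"
    and u: "u \<in> U" "u \<in> tensor_below n N" "u xs \<noteq> 0"
    and as: "length as = n" "distinct as" "set as \<inter> {..<N} = {}"
  obtains v where "v \<in> U" "v as \<noteq> 0" "\<And>zs. v zs \<noteq> 0 \<Longrightarrow> mset zs = mset as"
proof -
  have xs: "length xs = n" "set xs \<subseteq> {..<N}" using tensor_belowD[OF u(2,3)] .
  have ne: "xs ! i \<noteq> as ! j" if "i < n" "j < n" for i j
  proof -
    have "xs ! i \<in> {..<N}" "as ! j \<in> set as" using that xs as(1) by (auto simp: subset_iff)
    then show ?thesis using as(3) by (metis IntI empty_iff)
  qed
  \<comment> \<open>The induction records how often each fresh index occurs in every basis tensor of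
    v: exactly once if already introduced, otherwise never.\<close>
  have "\<exists>v\<in>U. v (take k as @ drop k xs) \<noteq> 0 \<and>
      (\<forall>zs. v zs \<noteq> 0 \<longrightarrow> length zs = n \<and> (\<forall>i<n. count (mset zs) (as ! i) = (if i < k then 1 else 0)))"
    if "k \<le> n" for k
    using that
  proof (induction k)
    case 0
    have "count (mset zs) (as ! i) = 0" if "u zs \<noteq> 0" "i < n" for zs i
    proof -
      have "as ! i \<in> set as" using that as(1) by simp
      then have "as ! i \<notin> set zs" using tensor_belowD(2)[OF u(2) that(1)] as(3) by blast
      then show ?thesis by (simp add: count_eq_zero_iff)
    qed
    then show ?case using u tensor_belowD(1)[OF u(2)] by (intro bexI[of _ u]) auto
  next
    case (Suc k)
    then have k: "k < n" by simp
    from Suc obtain v where v: "v \<in> U" "v (take k as @ drop k xs) \<noteq> 0"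
      "\<And>zs. v zs \<noteq> 0 \<Longrightarrow> length zs = n"
      "\<And>zs i. v zs \<noteq> 0 \<Longrightarrow> i < n \<Longrightarrow> count (mset zs) (as ! i) = (if i < k then 1 else 0)" by auto
    define w where "w = gl_act (munit (as ! k) (xs ! k)) n v"
    have w: "w = (\<lambda>zs. if length zs = n then \<Sum>j<n. if zs ! j = as ! k then v (zs[j := xs ! k]) else 0 else 0)"
      unfolding w_def by (rule gl_act_munit) (use v U in blast)
    have "w \<in> U" unfolding w_def using lam U v(1) by (rule gl_invariant_munit)
    moreover have "w (take (Suc k) as @ drop (Suc k) xs) \<noteq> 0"
    proof -
      let ?z = "take (Suc k) as @ drop (Suc k) xs"
      \<comment> \<open>Only place k of this list carries the fresh index \<open>as ! k\<close>, so
        the coefficient of w there is a single coefficient of v.\<close>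
      have iff: "?z ! j = as ! k \<longleftrightarrow> j = k" if "j < n" for j
        using take_append_drop_nth[OF as(1) xs(1) Suc.prems that] ne[of j k] that k as(1,2)
        by (auto simp: nth_eq_iff_index_eq less_Suc_eq)
      have "w ?z = (\<Sum>j<n. if ?z ! j = as ! k then v (?z[j := xs ! k]) else 0)"
        unfolding w using as(1) xs(1) Suc.prems by simp
      also have "\<dots> = (\<Sum>j<n. if j = k then v (take k as @ drop k xs) else 0)"
      proof (intro sum.cong refl)
        fix j assume "j \<in> {..<n}"
        then show "(if ?z ! j = as ! k then v (?z[j := xs ! k]) else 0) = (if j = k then v (take k as @ drop k xs) else 0)"
          using iff[of j] take_append_drop_update(2)[OF as(1) xs(1) k] by (cases "j = k") simp_all
      qed
      also have "\<dots> = v (take k as @ drop k xs)" using k by simp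
      finally show ?thesis using v(2) by simp
    qed
    moreover have "length zs = n \<and> (\<forall>i<n. count (mset zs) (as ! i) = (if i < Suc k then 1 else 0))"
      if "w zs \<noteq> 0" for zs
    proof -
      have len: "length zs = n" using that unfolding w by presburger
      then have "(\<Sum>j<n. if zs ! j = as ! k then v (zs[j := xs ! k]) else 0) \<noteq> 0"
        using that unfolding w by simp
      then obtain j where "j \<in> {..<n}" "(if zs ! j = as ! k then v (zs[j := xs ! k]) else 0) \<noteq> 0"
        by (rule sum.not_neutral_contains_not_neutral)
      then have j: "j < n" "zs ! j = as ! k" "v (zs[j := xs ! k]) \<noteq> 0" by (auto split: if_splits)
      have "count (mset zs) (as ! i) = (if i < Suc k then 1 else 0)" if "i < n" for i
      proof -
        have "as ! k = as ! i \<longleftrightarrow> i = k" using that k as by (auto simp: nth_eq_iff_index_eq)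
        then have "count (mset zs) (as ! i) = (if i < k then 1 else 0) + (if i = k then 1 else 0)"
          using count_mset_update[of j zs "xs ! k" "as ! i"] len j v(4)[OF j(3) that] ne[OF k that] by simp
        then show ?thesis by auto
      qed
      then show ?thesis using len by blast
    qed
    ultimately show ?case by blast
  qed
  from this[of n] obtain v where v: "v \<in> U" "v as \<noteq> 0"
    "\<And>zs. v zs \<noteq> 0 \<Longrightarrow> length zs = n \<and> (\<forall>i<n. count (mset zs) (as ! i) = 1)"
    using as(1) xs(1) by auto
  have "mset zs = mset as" if "v zs \<noteq> 0" for zs
  proof -
    have "count (mset as) a \<le> count (mset zs) a" for a
    proof (cases "a \<in> set as")
      case True
      then obtain i where "i < n" "a = as ! i" using as(1) by (metis in_set_conv_nth)
      then show ?thesis using v(3)[OF that] as(2) by (simp add: distinct_count_atmost_1)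
    next
      case False
      then show ?thesis by (simp add: count_eq_zero_iff[THEN iffD2])
    qed
    then have "mset as \<subseteq># mset zs" by (simp add: subseteq_mset_def)
    moreover have "size (mset as) = size (mset zs)" using v(3)[OF that] as(1) by simp
    ultimately show ?thesis by (metis mset_subset_size nless_le subset_mset.le_neq_trans subset_mset.less_le)
  qed
  then show ?thesis using v that by blast
qed

text \<open>A list with the same entries as \<open>as\<close> is a rearrangement of it, so p is
  obtained by reading off the coefficients of v; the inverse matches
  \<open>sym_act_tbasis\<close>.\<close>

lemma multiplicity_free_tensor:
  assumes as: "length as = n" "distinct as" and v: "\<And>zs. v zs \<noteq> 0 \<Longrightarrow> mset zs = mset as"
  obtains p where "p \<in> group_algebra n" "v = ga_act n p (tbasis as)"
proof -
  define p where "p \<sigma> = (if \<sigma> \<in> Perms n then v (permute_list (inv \<sigma>) as) else 0)" for \<sigma>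
  have "v zs = ga_act n p (tbasis as) zs" for zs
  proof (cases "mset zs = mset as")
    case True
    obtain \<tau> where "\<tau> permutes {..<length as}" "permute_list \<tau> as = zs"
      using mset_eq_permutation[OF True] by blast
    then have \<tau>: "\<tau> \<in> Perms n" "zs = permute_list (inv (inv \<tau>)) as"
      using as(1) by (auto simp: Perms_def permutes_inv_inv)
    show ?thesis unfolding \<tau>(2) using ga_act_tbasis_coeff[OF as inv_in_Perms[OF \<tau>(1)]] \<tau>
      by (simp add: p_def inv_in_Perms)
  next
    case False
    have "tbasis (permute_list (inv \<sigma>) as) zs = 0" if "\<sigma> \<in> Perms n" for \<sigma>
    proof -
      have "mset (permute_list (inv \<sigma>) as) = mset as"
        using inv_in_Perms[OF that] as(1) by (simp add: Perms_def)
      then show ?thesis using False by (auto simp: tbasis_def)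
    qed
    then have "ga_act n p (tbasis as) zs = 0" unfolding ga_act_tbasis[OF as(1)] by simp
    then show ?thesis using False v by auto
  qed
  then have "v = ga_act n p (tbasis as)" by blast
  moreover have "p \<in> group_algebra n" by (auto simp: group_algebra_def p_def)
  ultimately show ?thesis by (rule that[rotated])
qed

lemma gl_act_munit_tbasis:
  assumes zs: "length zs = n" "k < n" and only: "\<And>j. j < n \<Longrightarrow> zs ! j = zs ! k \<Longrightarrow> j = k"
  shows "gl_act (munit y (zs ! k)) n (tbasis zs) = tbasis (zs[k := y])"
proof
  fix vs
  show "gl_act (munit y (zs ! k)) n (tbasis zs) vs = tbasis (zs[k := y]) vs"
  proof (cases "length vs = n")
    case True
    have "vs[j := zs ! k] = zs \<Longrightarrow> j = k" if "j < n" for j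
      using only[OF that] True that by (metis nth_list_update_eq)
    moreover have "vs ! k = y \<and> vs[k := zs ! k] = zs \<longleftrightarrow> vs = zs[k := y]"
      using True zs by (metis list_update_id list_update_overwrite nth_list_update_eq)
    ultimately have "(if vs ! j = y then tbasis zs (vs[j := zs ! k]) else 0) =
        (if j = k then tbasis (zs[k := y]) vs else 0)" if "j < n" for j
      using that by (auto simp: tbasis_def)
    then show ?thesis using True zs by (simp add: gl_act_munit[OF tbasis_in])
  next
    case False
    then show ?thesis using zs(1) by (simp add: gl_act_munit[OF tbasis_in[OF zs(1)]]) (auto simp: tbasis_def)
  qed
qed

text \<open>The action of p commutes with matrix units, so only the basis tensor has to be
  rewritten. Since ws is distinct and disjoint from ys, each entry still to be replaced occurs just
  once. Repetitions in ys are allowed: a generic list can be specialised.\<close>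

lemma rename_entries:
  assumes lam: "lam \<notin> \<int> - {0}" and U: "gl_invariant lam n U" "U \<subseteq> tensor_space n"
    and ws: "length ws = n" "distinct ws" and ys: "length ys = n" "set ws \<inter> set ys = {}"
    and "ga_act n p (tbasis ws) \<in> U"
  shows "ga_act n p (tbasis ys) \<in> U"
proof -
  have "ga_act n p (tbasis (take k ys @ drop k ws)) \<in> U" if "k \<le> n" for k
    using that
  proof (induction k)
    case 0
    then show ?case using assms by simp
  next
    case (Suc k)
    let ?z = "take k ys @ drop k ws"
    have k: "k < n" using Suc.prems by simp
    have z: "length ?z = n" using ws ys Suc.prems by simp
    note nth = take_append_drop_nth[OF ys(1) ws(1) less_imp_le[OF k]]
    have zk: "?z ! k = ws ! k" using nth[OF k] by simp
    have "ys ! j \<noteq> ws ! k" if "j < n" for j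
      using that k ys ws by (metis IntI empty_iff nth_mem)
    then have only: "j = k" if "j < n" "?z ! j = ?z ! k" for j
      using that nth[OF that(1)] k ws unfolding zk by (auto simp: nth_eq_iff_index_eq split: if_splits)
    have "gl_act (munit (ys ! k) (?z ! k)) n (ga_act n p (tbasis ?z)) \<in> U"
      using Suc by (intro gl_invariant_munit[OF lam U]) simp
    also have "gl_act (munit (ys ! k) (?z ! k)) n (ga_act n p (tbasis ?z)) =
        ga_act n p (gl_act (munit (ys ! k) (?z ! k)) n (tbasis ?z))"
      by (rule gl_act_ga_act[OF tbasis_in[OF z]])
    also have "gl_act (munit (ys ! k) (?z ! k)) n (tbasis ?z) = tbasis (take (Suc k) ys @ drop (Suc k) ws)"
      using gl_act_munit_tbasis[OF z k only] take_append_drop_update(1)[OF ys(1) ws(1) k] by simp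
    finally show ?case .
  qed
  from this[of n] show ?thesis using ws ys by simp
qed

section \<open>The images of the Young symmetrizers and their minimality\<close>

definition schur_module :: "nat \<Rightarrow> nat list \<Rightarrow> tensor set" where
  "schur_module n \<nu> = ga_act n (young_symmetrizer n \<nu>) ` tensor_space n"

lemma schur_module_subset: "schur_module n \<nu> \<subseteq> tensor_space n"
  unfolding schur_module_def using ga_act_in_tensor_space by blast

lemma is_subspace_tensor_space: "is_subspace (tensor_space n)"
proof -
  have "(\<lambda>x. f x + g x) \<in> tensor_space n" if "f \<in> tensor_space n" "g \<in> tensor_space n" for f g
    using tensor_space_sum[of UNIV "\<lambda>b. if b then f else g" n "\<lambda>_. 1"] that
    by (simp add: UNIV_bool add.commute)
  moreover have "(\<lambda>x. c * f x) \<in> tensor_space n" if "f \<in> tensor_space n" for c f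
    using tensor_space_sum[of "{()}" "\<lambda>_. f" n "\<lambda>_. c"] that by simp
  moreover have "(\<lambda>_. 0) \<in> tensor_space n" by (simp add: tensor_space_def)
  ultimately show ?thesis unfolding is_subspace_def by blast
qed

lemma is_subspace_schur_module: "is_subspace (schur_module n \<nu>)"
proof -
  let ?c = "young_symmetrizer n \<nu>"
  note V = is_subspace_tensor_space[of n, unfolded is_subspace_def]
  have "ga_act n ?c (\<lambda>_. 0) = (\<lambda>_. 0)" using ga_act_scale_right[of n ?c 0] by simp
  then have "(\<lambda>_. 0) \<in> schur_module n \<nu>" unfolding schur_module_def using V by (metis imageI)
  moreover have "(\<lambda>x. ga_act n ?c f x + ga_act n ?c g x) \<in> schur_module n \<nu>"
    if "f \<in> tensor_space n" "g \<in> tensor_space n" for f g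
    using ga_act_lincomb_right[of n ?c 1 f 1 g] that V unfolding schur_module_def
    by (intro image_eqI[of _ _ "\<lambda>x. f x + g x"]) simp_all
  moreover have "(\<lambda>x. k * ga_act n ?c f x) \<in> schur_module n \<nu>" if "f \<in> tensor_space n" for k f
    using ga_act_scale_right[of n ?c k f] that V unfolding schur_module_def
    by (intro image_eqI[of _ _ "\<lambda>x. k * f x"]) simp_all
  ultimately show ?thesis unfolding is_subspace_def schur_module_def by blast
qed

lemma gl_invariant_schur_module: "gl_invariant lam n (schur_module n \<nu>)"
  unfolding gl_invariant_def schur_module_def
  using gl_act_ga_act gl_act_in_tensor_space by (auto simp: image_iff)

lemma schur_module_eigen:
  assumes "ga_mult n (young_symmetrizer n \<nu>) (young_symmetrizer n \<nu>) = (\<lambda>\<pi>. h * young_symmetrizer n \<nu> \<pi>)"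
    and "w \<in> schur_module n \<nu>"
  shows "ga_act n (young_symmetrizer n \<nu>) w = (\<lambda>xs. h * w xs)"
  using assms(2) unfolding schur_module_def by (auto simp flip: ga_act_mult simp: assms(1) ga_act_scale_left)

lemma schur_module_nonzero:
  assumes "\<nu> \<in> partitions n"
  shows "schur_module n \<nu> \<noteq> {\<lambda>_. 0}"
proof -
  have "ga_act n (young_symmetrizer n \<nu>) (tbasis [0..<n]) (permute_list (inv id) [0..<n]) = 1"
    using ga_act_tbasis_coeff[of "[0..<n]" n id] young_symmetrizer_id[OF assms] by simp
  moreover have "ga_act n (young_symmetrizer n \<nu>) (tbasis [0..<n]) \<in> schur_module n \<nu>"
    unfolding schur_module_def by (intro imageI tbasis_in) simp
  ultimately show ?thesis by (metis singletonD zero_neq_one)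
qed

text \<open>Minimality of the right ideal c A, in which p lies because c p = h p. If p y c were 0
  for all y, then h p y p = p y c p = 0 and so p = 0; and h p y c = c p y c is a multiple of
  c.\<close>

lemma right_multiple_young_symmetrizer:
  assumes \<nu>: "\<nu> \<in> partitions n" and p: "p \<in> group_algebra n" "p \<noteq> (\<lambda>_. 0)"
    and h: "h \<noteq> 0" "ga_mult n (young_symmetrizer n \<nu>) p = (\<lambda>\<pi>. h * p \<pi>)"
  obtains q where "ga_mult n p q = young_symmetrizer n \<nu>"
proof -
  let ?c = "young_symmetrizer n \<nu>"
  have p_eq: "p = (\<lambda>\<pi>. (1 / h) * ga_mult n ?c p \<pi>)" using h by (simp add: fun_eq_iff)
  have "\<exists>y. ga_mult n (ga_mult n p y) ?c \<noteq> (\<lambda>_. 0)"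
  proof (rule ccontr)
    assume z: "\<nexists>y. ga_mult n (ga_mult n p y) ?c \<noteq> (\<lambda>_. 0)"
    have "ga_mult n (ga_mult n p y) p = (\<lambda>_. 0)" for y
    proof -
      have "ga_mult n (ga_mult n p y) p = (\<lambda>\<pi>. (1 / h) * ga_mult n (ga_mult n (ga_mult n p y) ?c) p \<pi>)"
        by (subst (2) p_eq) (simp only: ga_mult_scale_right ga_mult_assoc)
      then show ?thesis using z by simp
    qed
    then have "p = (\<lambda>_. 0)" by (rule ga_sandwich_self_eq_0[OF p(1)])
    with p(2) show False by simp
  qed
  then obtain y where y: "ga_mult n (ga_mult n p y) ?c \<noteq> (\<lambda>_. 0)" by blast
  obtain k where k: "ga_mult n (ga_mult n ?c (ga_mult n p y)) ?c = (\<lambda>\<pi>. k * ?c \<pi>)"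
    using young_symmetrizer_sandwich[OF \<nu>] .
  have "ga_mult n (ga_mult n ?c (ga_mult n p y)) ?c = ga_mult n (ga_mult n (ga_mult n ?c p) y) ?c"
    by (simp only: ga_mult_assoc)
  also have "\<dots> = (\<lambda>\<pi>. h * ga_mult n (ga_mult n p y) ?c \<pi>)" by (simp only: h(2) ga_mult_scale_left)
  finally have e: "h * ga_mult n (ga_mult n p y) ?c \<pi> = k * ?c \<pi>" for \<pi> using k by (metis (no_types))
  have "k \<noteq> 0"
  proof
    assume "k = 0"
    then have "ga_mult n (ga_mult n p y) ?c \<pi> = 0" for \<pi> using e[of \<pi>] h(1) by simp
    then show False using y by blast
  qed
  \<comment> \<open>The witness is h / k times y c, read off from h p y c = k c.\<close>
  have "ga_mult n p (\<lambda>\<pi>. (h / k) * ga_mult n y ?c \<pi>) = (\<lambda>\<pi>. (h / k) * ga_mult n (ga_mult n p y) ?c \<pi>)"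
    by (simp only: ga_mult_scale_right ga_mult_assoc)
  also have "\<dots> = ?c" using e \<open>k \<noteq> 0\<close> by (simp add: fun_eq_iff)
  finally show ?thesis by (rule that)
qed

lemma schur_module_minimal:
  assumes lam: "lam \<notin> \<int> - {0}" and \<nu>: "\<nu> \<in> partitions n"
    and U: "is_subspace U" "U \<subseteq> schur_module n \<nu>" "gl_invariant lam n U" and "U \<noteq> {\<lambda>_. 0}"
  shows "U = schur_module n \<nu>"
proof -
  let ?c = "young_symmetrizer n \<nu>"
  have UT: "U \<subseteq> tensor_space n" using U(2) schur_module_subset by blast
  obtain h where h: "h \<noteq> 0" "ga_mult n ?c ?c = (\<lambda>\<pi>. h * ?c \<pi>)" using young_symmetrizer_square[OF \<nu>] .
  have "(\<lambda>_. 0) \<in> U" using U(1) by (simp add: is_subspace_def)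
  then obtain u where u: "u \<in> U" "u \<noteq> (\<lambda>_. 0)" using assms(6) by blast
  then obtain xs where xs: "u xs \<noteq> 0" by blast
  obtain N where N: "u \<in> tensor_below n N" using u(1) UT tensor_space_below by blast
  define as where "as = [N..<N + n]"
  have as: "length as = n" "distinct as" "set as \<inter> {..<N} = {}" by (auto simp: as_def)
  obtain v where v: "v \<in> U" "v as \<noteq> 0" "\<And>zs. v zs \<noteq> 0 \<Longrightarrow> mset zs = mset as"
    using move_to_fresh[OF lam U(3) UT u(1) N xs as] by blast
  obtain p where p: "p \<in> group_algebra n" "v = ga_act n p (tbasis as)"
    using multiplicity_free_tensor[OF as(1,2) v(3)] by blast
  have p0: "p \<noteq> (\<lambda>_. 0)" using p(2) v(2) by (auto simp: ga_act_def)
  \<comment> \<open>c_\<nu> acts on v as the scalar h; as v comes from a basis tensor with distinct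
    entries, this becomes an identity in A.\<close>
  have cp: "ga_mult n ?c p = (\<lambda>\<pi>. h * p \<pi>)"
  proof
    fix \<sigma>
    have "ga_act n (ga_mult n ?c p) (tbasis as) = ga_act n (\<lambda>\<pi>. h * p \<pi>) (tbasis as)"
      using schur_module_eigen[OF h(2), of v] v(1) U(2) unfolding ga_act_mult ga_act_scale_left p(2)[symmetric]
      by blast
    then show "ga_mult n ?c p \<sigma> = h * p \<sigma>"
      using ga_act_tbasis_coeff[OF as(1,2), of \<sigma>] group_algebraD[OF p(1), of \<sigma>] ga_mult_notin[of \<sigma> n]
      by (metis mult_zero_right)
  qed
  obtain q where q: "ga_mult n p q = ?c" using right_multiple_young_symmetrizer[OF \<nu> p(1) p0 h(1) cp] .
  have basis: "ga_act n ?c (tbasis ys) \<in> U" if ys: "length ys = n" for ys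
  proof -
    obtain K where K: "\<forall>y\<in>set ys. y < K" using finite_nat_set_iff_bounded[of "set ys"] by auto
    \<comment> \<open>The right factor q permutes the entries of the basis tensor, and renaming
      requires disjoint lists; hence the detour through a second fresh list, disjoint from both
      \<open>as\<close> and \<open>ys\<close>.\<close>
    define bs where "bs = [K + N + n..<K + N + n + n]"
    have bs: "length bs = n" "distinct bs" "set as \<inter> set bs = {}" "set bs \<inter> set ys = {}"
      using K by (auto simp: bs_def as_def)
    have "ga_act n (ga_mult n p (ga_delta \<sigma>)) (tbasis bs) \<in> U" if \<sigma>: "\<sigma> \<in> Perms n" for \<sigma>
    proof -
      have "length (permute_list (inv \<sigma>) bs) = n" "set as \<inter> set (permute_list (inv \<sigma>) bs) = {}"
        using bs(1,3) set_permute_list_Perms[OF inv_in_Perms[OF \<sigma>] bs(1)] by simp_all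
      then have "ga_act n p (tbasis (permute_list (inv \<sigma>) bs)) \<in> U"
        using v(1)[unfolded p(2)] by (rule rename_entries[OF lam U(3) UT as(1,2)])
      then show ?thesis by (simp add: ga_act_mult ga_act_delta[OF \<sigma>] sym_act_tbasis[OF \<sigma> bs(1)])
    qed
    then have "(\<lambda>xs. \<Sum>\<sigma>\<in>Perms n. q \<sigma> * ga_act n (ga_mult n p (ga_delta \<sigma>)) (tbasis bs) xs) \<in> U"
      by (rule is_subspace_sum[OF U(1)])
    then have "ga_act n (ga_mult n p q) (tbasis bs) \<in> U"
      unfolding ga_mult_expand_right[of n p q] ga_act_sum_left .
    then show ?thesis unfolding q by (rule rename_entries[OF lam U(3) UT bs(1,2) ys bs(4)])
  qed
  have "ga_act n ?c f \<in> U" if "f \<in> tensor_space n" for f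
  proof -
    have "(\<lambda>xs. \<Sum>ys\<in>{ys. f ys \<noteq> 0}. f ys * ga_act n ?c (tbasis ys) xs) \<in> U"
      using that by (intro is_subspace_sum[OF U(1)] basis) (simp add: tensor_space_def)
    then show ?thesis by (subst tensor_expand[OF that]) (simp only: ga_act_sum_right)
  qed
  then show ?thesis using U(2) unfolding schur_module_def by blast
qed

lemma schur_module_irreducible:
  assumes "lam \<notin> \<int> - {0}" "\<nu> \<in> partitions n"
  shows "gl_irreducible_sub lam n (schur_module n \<nu>)"
  unfolding gl_irreducible_sub_def
  using is_subspace_schur_module schur_module_subset gl_invariant_schur_module
    schur_module_nonzero[OF assms(2)] schur_module_minimal[OF assms] by blast

section \<open>The decomposition\<close>

text \<open>Expand the unit in the elements g c_\<nu> g^{-1} and write c_\<nu> as c_\<nu> c_\<nu> /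
  h_\<nu>. The left part g c_\<nu> lies in the Specht module, and c_\<nu> g^{-1} f lies in
  \<open>schur_module n \<nu>\<close>; this is the origin of the coefficient
  \<open>\<alpha> \<nu> / h \<nu>\<close>.\<close>

lemma decomposition_surjective:
  assumes f: "f \<in> tensor_space n"
  shows "\<exists>(k::nat) (\<mu> :: nat \<Rightarrow> nat list) (w :: nat \<Rightarrow> tensor) (s :: nat \<Rightarrow> galg).
        (\<forall>i<k. \<mu> i \<in> partitions n \<and> w i \<in> schur_module n (\<mu> i) \<and> s i \<in> specht n (\<mu> i)) \<and>
        f = (\<lambda>xs. \<Sum>i<k. ga_act n (s i) (w i) xs)"
proof -
  let ?c = "young_symmetrizer n"
  obtain \<alpha> where \<alpha>: "ga_delta id = (\<lambda>\<pi>. \<Sum>\<nu>\<in>partitions n. \<alpha> \<nu> * class_sum n \<nu> \<pi>)"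
    using unit_in_span_class_sums .
  have "\<exists>h. h \<noteq> 0 \<and> ga_mult n (?c \<nu>) (?c \<nu>) = (\<lambda>\<pi>. h * ?c \<nu> \<pi>)" if "\<nu> \<in> partitions n" for \<nu>
    using young_symmetrizer_square[OF that] by metis
  then obtain h where h: "\<And>\<nu>. \<nu> \<in> partitions n \<Longrightarrow> h \<nu> \<noteq> 0"
    "\<And>\<nu>. \<nu> \<in> partitions n \<Longrightarrow> ga_mult n (?c \<nu>) (?c \<nu>) = (\<lambda>\<pi>. h \<nu> * ?c \<nu> \<pi>)" by metis
  define W where "W = (\<lambda>(\<nu>, g). ga_act n (?c \<nu>) (sym_act n (inv g) f))"
  define S where "S = (\<lambda>(\<nu>, g). ga_mult n (\<lambda>\<pi>. \<alpha> \<nu> / h \<nu> * ga_delta g \<pi>) (?c \<nu>))"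
  define I where "I = partitions n \<times> Perms n"
  have W: "W i \<in> schur_module n (fst i)" if "i \<in> I" for i
    using that f unfolding W_def I_def schur_module_def
    by (auto intro!: sym_act_in_tensor_space inv_in_Perms)
  have S: "S i \<in> specht n (fst i)" if "i \<in> I" for i
  proof -
    have "(\<lambda>\<pi>. \<alpha> (fst i) / h (fst i) * ga_delta (snd i) \<pi>) \<in> group_algebra n"
      using that ga_delta_in[of "snd i" n] unfolding I_def group_algebra_def by auto
    then show ?thesis unfolding specht_def S_def case_prod_beta by blast
  qed
  have SW: "ga_act n (S (\<nu>, g)) (W (\<nu>, g)) =
      (\<lambda>xs. \<alpha> \<nu> * ga_act n (ga_mult n (ga_mult n (ga_delta g) (?c \<nu>)) (ga_delta (inv g))) f xs)"
    if \<nu>: "\<nu> \<in> partitions n" and g: "g \<in> Perms n" for \<nu> g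
  proof -
    have "ga_act n (S (\<nu>, g)) (W (\<nu>, g)) =
        ga_act n (ga_mult n (S (\<nu>, g)) (ga_mult n (?c \<nu>) (ga_delta (inv g)))) f"
      by (simp add: W_def ga_act_mult ga_act_delta inv_in_Perms[OF g])
    also have "ga_mult n (S (\<nu>, g)) (ga_mult n (?c \<nu>) (ga_delta (inv g))) =
        (\<lambda>\<pi>. \<alpha> \<nu> / h \<nu> * ga_mult n (ga_delta g) (ga_mult n (ga_mult n (?c \<nu>) (?c \<nu>)) (ga_delta (inv g))) \<pi>)"
      by (simp only: S_def case_prod_conv ga_mult_scale_left ga_mult_assoc)
    also have "\<dots> = (\<lambda>\<pi>. \<alpha> \<nu> * ga_mult n (ga_mult n (ga_delta g) (?c \<nu>)) (ga_delta (inv g)) \<pi>)"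
      unfolding h(2)[OF \<nu>] ga_mult_scale_left ga_mult_scale_right using h(1)[OF \<nu>] by (simp add: ga_mult_assoc)
    finally show ?thesis by (simp only: ga_act_scale_left)
  qed
  have finI: "finite I" unfolding I_def using finite_partitions by simp
  have "f = ga_act n (ga_delta id) f" using ga_act_one[OF f] by simp
  also have "\<dots> = (\<lambda>xs. \<Sum>\<nu>\<in>partitions n. \<Sum>g\<in>Perms n. ga_act n (S (\<nu>, g)) (W (\<nu>, g)) xs)"
    unfolding \<alpha> ga_act_sum_left class_sum_def
    by (intro ext sum.cong refl) (simp add: SW sum_distrib_left)
  also have "\<dots> = (\<lambda>xs. \<Sum>i\<in>I. ga_act n (S i) (W i) xs)"
    unfolding I_def by (simp add: sum.cartesian_product)
  finally have fI: "f = (\<lambda>xs. \<Sum>i\<in>I. ga_act n (S i) (W i) xs)" .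
  obtain e where e: "bij_betw e {..<card I} I"
    using ex_bij_betw_nat_finite[OF finI] by (auto simp: atLeast0LessThan)
  then have "(\<Sum>i<card I. ga_act n (S (e i)) (W (e i)) xs) = (\<Sum>i\<in>I. ga_act n (S i) (W i) xs)" for xs
    by (rule sum.reindex_bij_betw)
  then have "f = (\<lambda>xs. \<Sum>i<card I. ga_act n (S (e i)) (W (e i)) xs)" using fI by simp
  moreover have "e i \<in> I" if "i < card I" for i using bij_betwE[OF e] that by simp
  ultimately show ?thesis using W S unfolding I_def
    by (intro exI[of _ "card I"] exI[of _ "fst \<circ> e"] exI[of _ "W \<circ> e"] exI[of _ "S \<circ> e"])
      (auto simp: I_def mem_Times_iff)
qed

lemma decomposition_injective:
  assumes indep: "\<And>\<nu>. \<nu> \<in> partitions n \<Longrightarrow> lin_indep_family (k \<nu>) (s \<nu>)"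
    and w: "\<And>\<nu> i. \<nu> \<in> partitions n \<Longrightarrow> i < k \<nu> \<Longrightarrow> w \<nu> i \<in> schur_module n \<nu>"
    and s: "\<And>\<nu> i. \<nu> \<in> partitions n \<Longrightarrow> i < k \<nu> \<Longrightarrow> s \<nu> i \<in> specht n \<nu>"
    and zero: "\<And>xs. (\<Sum>\<nu>\<in>partitions n. \<Sum>i<k \<nu>. ga_act n (s \<nu> i) (w \<nu> i) xs) = 0"
    and \<mu>: "\<mu> \<in> partitions n" and j: "j < k \<mu>"
  shows "w \<mu> j = (\<lambda>_. 0)"
proof
  fix xs
  let ?c = "young_symmetrizer n"
  obtain h where h: "h \<noteq> 0" "ga_mult n (?c \<mu>) (?c \<mu>) = (\<lambda>\<pi>. h * ?c \<mu> \<pi>)"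
    using young_symmetrizer_square[OF \<mu>] .
  have "\<exists>g. s \<nu> i = ga_mult n g (?c \<nu>)" if "\<nu> \<in> partitions n" "i < k \<nu>" for \<nu> i
    using s[OF that] unfolding specht_def by blast
  then obtain g where g: "\<And>\<nu> i. \<nu> \<in> partitions n \<Longrightarrow> i < k \<nu> \<Longrightarrow> s \<nu> i = ga_mult n (g \<nu> i) (?c \<nu>)" by metis
  \<comment> \<open>At the fixed coordinate xs the values of the w_i are numbers, and t is the
    combination of the s_i with these coefficients. By linear independence it remains to show t =
    0.\<close>
  define t where "t = (\<lambda>\<pi>. \<Sum>i<k \<mu>. w \<mu> i xs * s \<mu> i \<pi>)"
  have t: "t = ga_mult n (\<lambda>\<pi>. \<Sum>i<k \<mu>. w \<mu> i xs * g \<mu> i \<pi>) (?c \<mu>)"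
    unfolding t_def ga_mult_sum_left using g[OF \<mu>] by simp
  \<comment> \<open>Apply c_\<mu> y to the relation: the other shapes vanish, c_\<mu> y s_i =
    \<phi>_i c_\<mu>, and c_\<mu> acts on w_i as h. So the numbers w_i(xs) \<phi>_i add up to 0, and
    their sum is the factor of c_\<mu> in c_\<mu> y t.\<close>
  have ct: "ga_mult n (ga_mult n (?c \<mu>) y) t = (\<lambda>_. 0)" for y
  proof -
    let ?a = "ga_mult n (?c \<mu>) y"
    have "\<exists>\<phi>. ga_mult n ?a (s \<mu> i) = (\<lambda>\<pi>. \<phi> * ?c \<mu> \<pi>)" if i: "i < k \<mu>" for i
    proof -
      have "ga_mult n ?a (s \<mu> i) = ga_mult n (ga_mult n (?c \<mu>) (ga_mult n y (g \<mu> i))) (?c \<mu>)"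
        unfolding g[OF \<mu> i] by (simp only: ga_mult_assoc)
      then show ?thesis using young_symmetrizer_sandwich[OF \<mu>] by metis
    qed
    then obtain \<phi> where \<phi>: "\<And>i. i < k \<mu> \<Longrightarrow> ga_mult n ?a (s \<mu> i) = (\<lambda>\<pi>. \<phi> i * ?c \<mu> \<pi>)" by metis
    have other: "ga_mult n ?a (s \<nu> i) = (\<lambda>_. 0)" if "\<nu> \<in> partitions n" "i < k \<nu>" "\<nu> \<noteq> \<mu>" for \<nu> i
    proof -
      have "ga_mult n ?a (s \<nu> i) = ga_mult n (ga_mult n (?c \<mu>) (ga_mult n y (g \<nu> i))) (?c \<nu>)"
        unfolding g[OF that(1,2)] by (simp only: ga_mult_assoc)
      then show ?thesis using young_symmetrizer_orthogonal[OF \<mu> that(1)] that(3) by simp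
    qed
    have "0 = ga_act n ?a (\<lambda>xs. \<Sum>\<nu>\<in>partitions n. 1 * (\<Sum>i<k \<nu>. 1 * ga_act n (s \<nu> i) (w \<nu> i) xs)) xs"
      using ga_act_scale_right[of n ?a 0] by (simp add: zero)
    also have "\<dots> = (\<Sum>\<nu>\<in>partitions n. \<Sum>i<k \<nu>. ga_act n (ga_mult n ?a (s \<nu> i)) (w \<nu> i) xs)"
      unfolding ga_act_sum_right ga_act_mult by simp
    also have "\<dots> = (\<Sum>\<nu>\<in>{\<mu>}. \<Sum>i<k \<nu>. ga_act n (ga_mult n ?a (s \<nu> i)) (w \<nu> i) xs)"
    proof (rule sum.mono_neutral_right)
      show "\<forall>\<nu>\<in>partitions n - {\<mu>}. (\<Sum>i<k \<nu>. ga_act n (ga_mult n ?a (s \<nu> i)) (w \<nu> i) xs) = 0"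
        by (intro ballI sum.neutral) (simp add: other ga_act_def)
    qed (use \<mu> finite_partitions in auto)
    also have "\<dots> = (\<Sum>i<k \<mu>. h * (w \<mu> i xs * \<phi> i))"
      using schur_module_eigen[OF h(2) w[OF \<mu>]] by (simp add: \<phi> ga_act_scale_left mult.left_commute mult.commute)
    finally have "h * (\<Sum>i<k \<mu>. w \<mu> i xs * \<phi> i) = 0" by (simp add: sum_distrib_left)
    then have "(\<Sum>i<k \<mu>. w \<mu> i xs * \<phi> i) = 0" using h(1) by simp
    moreover have "ga_mult n ?a t = (\<lambda>\<pi>. (\<Sum>i<k \<mu>. w \<mu> i xs * \<phi> i) * ?c \<mu> \<pi>)"
      unfolding t_def ga_mult_sum_right by (simp add: \<phi> sum_distrib_right mult.assoc)
    ultimately show ?thesis by simp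
  qed
  have "t = (\<lambda>_. 0)"
  proof (rule ga_sandwich_self_eq_0)
    show "t \<in> group_algebra n" unfolding t by simp
    fix y
    \<comment> \<open>t has c_\<mu> as a right factor, so t y t ends in c_\<mu> y t = 0.\<close>
    show "ga_mult n (ga_mult n t y) t = (\<lambda>_. 0)"
      by (subst (1) t) (simp only: ga_mult_assoc ct[unfolded ga_mult_assoc] ga_mult_zero)
  qed
  then have "\<forall>\<pi>. (\<Sum>i<k \<mu>. w \<mu> i xs * s \<mu> i \<pi>) = 0" unfolding t_def by meson
  then show "w \<mu> j xs = 0" 
    using indep[OF \<mu>, unfolded lin_indep_family_def, THEN spec, of "\<lambda>i. w \<mu> i xs"] j by blast
qed

theorem theorem7p2:
  fixes lam :: complex and n :: nat
  assumes "lam \<notin> \<int> - {0}"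
    and "n \<ge> 1"
  shows "\<exists>W B. schur_weyl_decomposition lam n W B"
proof -
  have in_space: "w \<in> tensor_space n" if "w \<in> schur_module n \<nu>" for w \<nu>
    using that schur_module_subset by blast
  have "schur_weyl_decomposition lam n (schur_module n) (\<lambda>\<nu> w s. ga_act n s w)"
    unfolding schur_weyl_decomposition_def
  proof (intro conjI ballI allI impI)
    fix \<nu> assume "\<nu> \<in> partitions n"
    then show "gl_irreducible_sub lam n (schur_module n \<nu>)" by (rule schur_module_irreducible[OF assms(1)])
  next
    fix \<nu>
    show "bilinear_on (schur_module n \<nu>) (specht n \<nu>) (\<lambda>w s. ga_act n s w)"
      unfolding bilinear_on_def by (simp add: ga_act_lincomb_left ga_act_lincomb_right)
  next
    fix \<nu> w s assume "w \<in> schur_module n \<nu>"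
    then show "ga_act n s w \<in> tensor_space n" by (intro ga_act_in_tensor_space in_space)
  next
    fix \<nu> T w s assume "w \<in> schur_module n \<nu>"
    then show "gl_act T n (ga_act n s w) = ga_act n s (gl_act T n w)" by (intro gl_act_ga_act in_space)
  next
    fix \<nu> \<sigma> w s assume "\<sigma> \<in> Perms n"
    then show "sym_act n \<sigma> (ga_act n s w) = ga_act n (specht_act n \<sigma> s) w"
      by (simp add: specht_act_def ga_act_mult ga_act_delta)
  next
    fix f assume "f \<in> tensor_space n"
    then show "\<exists>(k::nat) (\<mu> :: nat \<Rightarrow> nat list) (w :: nat \<Rightarrow> tensor) (s :: nat \<Rightarrow> galg).
        (\<forall>i<k. \<mu> i \<in> partitions n \<and> w i \<in> schur_module n (\<mu> i) \<and> s i \<in> specht n (\<mu> i)) \<and>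
        f = (\<lambda>xs. \<Sum>i<k. ga_act n (s i) (w i) xs)"
      by (rule decomposition_surjective)
  next
    fix k :: "nat list \<Rightarrow> nat" and w :: "nat list \<Rightarrow> nat \<Rightarrow> tensor" and s :: "nat list \<Rightarrow> nat \<Rightarrow> galg" and \<nu> i
    assume hyp: "(\<forall>\<nu>\<in>partitions n. lin_indep_family (k \<nu>) (s \<nu>) \<and>
        (\<forall>i<k \<nu>. w \<nu> i \<in> schur_module n \<nu> \<and> s \<nu> i \<in> specht n \<nu>)) \<and>
        (\<forall>xs. (\<Sum>\<nu>\<in>partitions n. \<Sum>i<k \<nu>. ga_act n (s \<nu> i) (w \<nu> i) xs) = 0)"
      and "\<nu> \<in> partitions n" "i < k \<nu>"
    then show "w \<nu> i = (\<lambda>_. 0)" by (intro decomposition_injective[of n k s w]) auto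
  qed
  then show ?thesis by blast
qed

end
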